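(* Let $(M,c)$ be a conformal manifold of dimension at least $3$. Then the mixed Schouten-Weyl tensor $\mu$ of any hypersurface $N\subset M$ is identically zero.
   Context: All objects are smooth. On an $m$-manifold $M$, for $k\in\mathbb R$, $L^k$ is the oriented real line bundle associated with the frame bundle and the representation $|\det|^{k/m}$. A conformal structure $c$ is a positive-definite section of $S^2T^*M\otimes L^2$, normalized by $|\det c|=1$; equivalently it is the conformal class of metrics $l^{-2}c$, for $l$ a positive section of $L$. Via $c$, $T^*M\cong TM\otimes L^{-2}$; inner products and traces $\mathrm{tr}_c$ are taken with these weights. A Weyl structure $\nabla$ is a torsion-free connection on $TM$ with $\nabla c=0$ (with the induced connection on $L$). $F^\nabla\in\Lambda^2T^*M$ (Faraday form) is the curvature of the connection induced by $\nabla$ on $L$. Put $R^\nabla_{X,Y}Z=\nabla_X\nabla_YZ-\nabla_Y\nabla_XZ-\nabla_{[X,Y]}Z$, $\mathrm{Ric}^\nabla(X,Y)=\mathrm{tr}(Z\mapsto R^\nabla_{Z,X}Y)$, $\mathrm{Scal}^\nabla=\mathrm{tr}_c\mathrm{Ric}^\nabla$, $\sigma^\nabla=\frac{1}{2(m-1)}\mathrm{Scal}^\nabla$. For $m\ge3$ the Schouten-Weyl tensor is $h^\nabla=\frac1{m-2}\mathrm{Ric}^{\nabla,s}_0+\frac1m\sigma^\nabla c-\frac12F^\nabla\in T^*M\otimes T^*M$, where $\mathrm{Ric}^{\nabla,s}_0$ is the symmetric trace-free part of $\mathrm{Ric}^\nabla$. Submanifolds. $N^n\subset M^m$ carries the induced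 conformal structure $c$; $\nu$ is its normal bundle, $TM|_N=TN\oplus\nu$, with components denoted by $(\cdot)^N,(\cdot)^\perp$. For a Weyl structure $\nabla$ on $M$: $\nabla^N_XY=(\nabla_XY)^N$ is the induced Weyl structure on $N$; $\nabla^\perp_X\xi=(\nabla_X\xi)^\perp$ is the induced connection on $\nu$; $B^\nabla(X,Y)=(\nabla_XY)^\perp$ ($X,Y\in TN$) is the fundamental form; $H^\nabla\in\nu^*\cong\nu\otimes L^{-2}$, $H^\nabla(\xi)=-\frac1n\mathrm{tr}(X\mapsto(\nabla_X\xi)^N)$, is the mean curvature; $B^\nabla=H^\nabla\cdot c+B_0$ with $B_0\in S^2_0T^*N\otimes\nu$ trace-free, independent of $\nabla$. The mixed Schouten-Weyl tensor $\mu\in T^*N\otimes\nu^*$ of $N\subset M$ (for $n\ge 2$) is $$\mu_X(\xi)=h^\nabla(X,\xi)-(\nabla_XH^\nabla)(\xi)+\tfrac1{n-1}(\delta^\nabla B_0)(X)(\xi),\quad X\in TN,\ \xi\in\nu,$$ where $(\delta^\nabla B_0)(X)=\mathrm{tr}^c_{TN}((\nabla_\cdot B_0)(X,\cdot))\in\nu\otimes L^{-2}\cong\nu^*$ and the covariant derivatives are induced by $\nabla^N,\nabla^\perp$; it is independent of the Weyl structure $\nabla$ on $M$. *)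

theory Defs
  imports "HOL-Analysis.Analysis"
begin

section \<open>Smooth maps and manifolds\<close>

text \<open>
  The notion is meant for open \<open>S\<close> in a finite-dimensional space, where continuity of all
  iterated directional derivatives up to order \<open>k\<close> is equivalent to being of class \<open>C^k\<close>.
\<close>

primrec Ck_on :: "nat \<Rightarrow> 'e::real_normed_vector set \<Rightarrow> ('e \<Rightarrow> 'f::real_normed_vector) \<Rightarrow> bool"
  where
    "Ck_on 0 S f \<longleftrightarrow> continuous_on S f"
  | "Ck_on (Suc k) S f \<longleftrightarrow>
       (\<forall>x\<in>S. f differentiable (at x)) \<and>
       (\<forall>v. Ck_on k S (\<lambda>x. frechet_derivative f (at x) v))"

definition smooth_on :: "'e::real_normed_vector set \<Rightarrow> ('e \<Rightarrow> 'f::real_normed_vector) \<Rightarrow> bool"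
  where "smooth_on S f \<longleftrightarrow> (\<forall>k. Ck_on k S f)"

text \<open>A chart is a pair of its domain and its coordinate map (irrelevant off the domain).\<close>

type_synonym ('a, 'm) chart = "'a set \<times> ('a \<Rightarrow> real ^ 'm)"

definition is_chart :: "'a topology \<Rightarrow> ('a, 'm::finite) chart \<Rightarrow> bool"
  where "is_chart T \<phi> \<longleftrightarrow>
    openin T (fst \<phi>) \<and> open (snd \<phi> ` fst \<phi>) \<and>
    homeomorphic_map (subtopology T (fst \<phi>)) (top_of_set (snd \<phi> ` fst \<phi>)) (snd \<phi>)"

text \<open>
  The change of coordinates \<open>\<phi>\<^sub>2 \<circ> \<phi>\<^sub>1\<inverse>\<close> and the part of the coordinate domain of \<open>\<phi>\<^sub>1\<close> on which
  it is meaningful.  The two charts may have different dimensions: if \<open>\<phi>\<^sub>1\<close> is a chart of a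
  submanifold and \<open>\<phi>\<^sub>2\<close> one of the ambient manifold, this is the inclusion in coordinates.
\<close>

definition overlap :: "('a, 'n::finite) chart \<Rightarrow> ('a, 'm::finite) chart \<Rightarrow> (real ^ 'n) set"
  where "overlap \<phi>1 \<phi>2 = snd \<phi>1 ` (fst \<phi>1 \<inter> fst \<phi>2)"

definition transition ::
    "('a, 'n::finite) chart \<Rightarrow> ('a, 'm::finite) chart \<Rightarrow> real ^ 'n \<Rightarrow> real ^ 'm"
  where "transition \<phi>1 \<phi>2 = snd \<phi>2 \<circ> inv_into (fst \<phi>1) (snd \<phi>1)"

definition smooth_manifold :: "'a topology \<Rightarrow> ('a, 'm::finite) chart set \<Rightarrow> bool"
  where "smooth_manifold T A \<longleftrightarrow>
    Hausdorff_space T \<and> second_countable T \<and>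
    (\<forall>\<phi>\<in>A. is_chart T \<phi>) \<and> \<Union> (fst ` A) = topspace T \<and>
    (\<forall>\<phi>1\<in>A. \<forall>\<phi>2\<in>A. smooth_on (overlap \<phi>1 \<phi>2) (transition \<phi>1 \<phi>2))"

text \<open>
  A submanifold is a subset of the ambient manifold, itself a manifold, whose inclusion is a
  smooth immersion.  Its topology may be finer than the induced one, so that both embedded and
  (injectively) immersed submanifolds are covered.
\<close>

definition submanifold ::
    "'a topology \<Rightarrow> ('a, 'm::finite) chart set \<Rightarrow> 'a topology \<Rightarrow> ('a, 'n::finite) chart set \<Rightarrow> bool"
  where "submanifold T A T' B \<longleftrightarrow>
    smooth_manifold T' B \<and> topspace T' \<subseteq> topspace T \<and>
    (\<forall>\<psi>\<in>B. \<forall>\<phi>\<in>A.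
       openin T' (fst \<psi> \<inter> fst \<phi>) \<and>
       smooth_on (overlap \<psi> \<phi>) (transition \<psi> \<phi>) \<and>
       (\<forall>q\<in>overlap \<psi> \<phi>. inj (frechet_derivative (transition \<psi> \<phi>) (at q))))"


section \<open>Conformal structures\<close>

text \<open>
  A section of a bundle associated with the frame bundle is given by its components in the
  coordinate frame of each chart.  The coordinate frame of \<open>\<phi>\<close> also trivialises \<open>L\<close>; for a
  coordinate change with Jacobian \<open>J\<close> the components of a section of \<open>L^k\<close> get multiplied by
  \<open>\<bar>det J\<bar>^(k/m)\<close>, those of a vector field by \<open>J\<close>.  This gives the transformation law for a
  section \<open>c\<close> of \<open>S^2 T*M \<otimes> L^2\<close>.
\<close>

definition form :: "real ^ 'm ^ 'm \<Rightarrow> real ^ 'm \<Rightarrow> real ^ 'm \<Rightarrow> real"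
  where "form C u v = u \<bullet> (C *v v)"

type_synonym ('a, 'm) bilinear_components = "('a, 'm) chart \<Rightarrow> real ^ 'm \<Rightarrow> real ^ 'm ^ 'm"

definition conformal_structure ::
    "('a, 'm::finite) chart set \<Rightarrow> ('a, 'm) bilinear_components \<Rightarrow> bool"
  where "conformal_structure A c \<longleftrightarrow>
    (\<forall>\<phi>\<in>A. smooth_on (snd \<phi> ` fst \<phi>) (c \<phi>) \<and>
       (\<forall>x\<in>snd \<phi> ` fst \<phi>.
          transpose (c \<phi> x) = c \<phi> x \<and>
          (\<forall>u. u \<noteq> 0 \<longrightarrow> form (c \<phi> x) u u > 0) \<and>
          \<bar>det (c \<phi> x)\<bar> = 1)) \<and>
    (\<forall>\<phi>1\<in>A. \<forall>\<phi>2\<in>A. \<forall>x\<in>overlap \<phi>1 \<phi>2.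
       let J = frechet_derivative (transition \<phi>1 \<phi>2) (at x) in
         \<forall>u v. form (c \<phi>2 (transition \<phi>1 \<phi>2 x)) (J u) (J v) =
               \<bar>det (matrix J)\<bar> powr (2 / real CARD('m)) * form (c \<phi>1 x) u v)"

definition conformal_manifold ::
    "'a topology \<Rightarrow> ('a, 'm::finite) chart set \<Rightarrow> ('a, 'm) bilinear_components \<Rightarrow> bool"
  where "conformal_manifold T A c \<longleftrightarrow> smooth_manifold T A \<and> conformal_structure A c"


section \<open>Connections and their curvature\<close>

text \<open>
  Index convention for Christoffel symbols:
  \<open>\<nabla>\<^bsub>\<partial>i\<^esub> \<partial>j = (\<Sum>k. G $ k $ i $ j *\<^sub>R \<partial>k)\<close>.  In this section \<open>G\<close> denotes the Christoffel symbols
  in one chart, and vector fields are functions on the coordinate domain.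
\<close>

definition christoffel :: "real ^ 'm ^ 'm ^ 'm \<Rightarrow> real ^ 'm \<Rightarrow> real ^ 'm \<Rightarrow> real ^ 'm"
  where "christoffel g u v = (\<chi> k. \<Sum>i\<in>UNIV. \<Sum>j\<in>UNIV. g $ k $ i $ j * u $ i * v $ j)"

definition nabla_T ::
    "(real ^ 'm \<Rightarrow> real ^ 'm ^ 'm ^ 'm) \<Rightarrow> (real ^ 'm \<Rightarrow> real ^ 'm) \<Rightarrow> (real ^ 'm \<Rightarrow> real ^ 'm)
      \<Rightarrow> real ^ 'm \<Rightarrow> real ^ 'm"
  where "nabla_T G X Y x = frechet_derivative Y (at x) (X x) + christoffel (G x) (X x) (Y x)"

text \<open>
  The connection induced on \<open>L^k\<close>: differentiating the representation \<open>\<bar>det\<bar>^(k/m)\<close> at the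
  identity gives \<open>(k/m) * tr\<close>, so the connection form of \<open>L^k\<close> in the coordinate
  trivialisation is \<open>k/m\<close> times the trace of the connection form of \<open>TM\<close>.
\<close>

definition nabla_L ::
    "real \<Rightarrow> (real ^ 'm \<Rightarrow> real ^ 'm ^ 'm ^ 'm) \<Rightarrow> (real ^ 'm \<Rightarrow> real ^ 'm) \<Rightarrow> (real ^ 'm \<Rightarrow> real)
      \<Rightarrow> real ^ 'm \<Rightarrow> real"
  where "nabla_L k G X l x =
    frechet_derivative l (at x) (X x)
    + k / real CARD('m) * (\<Sum>i\<in>UNIV. christoffel (G x) (X x) (axis i 1) $ i) * l x"

definition lie_bracket ::
    "(real ^ 'm \<Rightarrow> real ^ 'm) \<Rightarrow> (real ^ 'm \<Rightarrow> real ^ 'm) \<Rightarrow> real ^ 'm \<Rightarrow> real ^ 'm"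
  where "lie_bracket X Y x = frechet_derivative Y (at x) (X x) - frechet_derivative X (at x) (Y x)"

definition curvature ::
    "(real ^ 'm \<Rightarrow> real ^ 'm ^ 'm ^ 'm) \<Rightarrow> (real ^ 'm \<Rightarrow> real ^ 'm) \<Rightarrow> (real ^ 'm \<Rightarrow> real ^ 'm)
      \<Rightarrow> (real ^ 'm \<Rightarrow> real ^ 'm) \<Rightarrow> real ^ 'm \<Rightarrow> real ^ 'm"
  where "curvature G X Y Z x =
    nabla_T G X (nabla_T G Y Z) x - nabla_T G Y (nabla_T G X Z) x
    - nabla_T G (lie_bracket X Y) Z x"

definition curvature_L ::
    "(real ^ 'm \<Rightarrow> real ^ 'm ^ 'm ^ 'm) \<Rightarrow> (real ^ 'm \<Rightarrow> real ^ 'm) \<Rightarrow> (real ^ 'm \<Rightarrow> real ^ 'm)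
      \<Rightarrow> (real ^ 'm \<Rightarrow> real) \<Rightarrow> real ^ 'm \<Rightarrow> real"
  where "curvature_L G X Y l x =
    nabla_L 1 G X (nabla_L 1 G Y l) x - nabla_L 1 G Y (nabla_L 1 G X l) x
    - nabla_L 1 G (lie_bracket X Y) l x"

text \<open>
  The curvature tensors are evaluated on vectors at \<open>x\<close> by extending these to vector fields
  with constant components.
\<close>

definition faraday ::
    "(real ^ 'm \<Rightarrow> real ^ 'm ^ 'm ^ 'm) \<Rightarrow> real ^ 'm \<Rightarrow> real ^ 'm \<Rightarrow> real ^ 'm \<Rightarrow> real"
  where "faraday G x u v = curvature_L G (\<lambda>_. u) (\<lambda>_. v) (\<lambda>_. 1) x"

definition ricci ::
    "(real ^ 'm \<Rightarrow> real ^ 'm ^ 'm ^ 'm) \<Rightarrow> real ^ 'm \<Rightarrow> real ^ 'm \<Rightarrow> real ^ 'm \<Rightarrow> real"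
  where "ricci G x u v = (\<Sum>k\<in>UNIV. curvature G (\<lambda>_. axis k 1) (\<lambda>_. u) (\<lambda>_. v) x $ k)"

text \<open>
  From here on \<open>C\<close> denotes the components of the conformal structure in the same chart.
  Weighted quantities (such as \<open>scal\<close>, a section of \<open>L^(-2)\<close>) are expressed in the
  coordinate trivialisation of \<open>L\<close>.
\<close>

definition scal ::
    "(real ^ 'm \<Rightarrow> real ^ 'm ^ 'm) \<Rightarrow> (real ^ 'm \<Rightarrow> real ^ 'm ^ 'm ^ 'm) \<Rightarrow> real ^ 'm \<Rightarrow> real"
  where "scal C G x =
    (\<Sum>i\<in>UNIV. \<Sum>j\<in>UNIV. matrix_inv (C x) $ i $ j * ricci G x (axis i 1) (axis j 1))"

definition sigma ::
    "(real ^ 'm \<Rightarrow> real ^ 'm ^ 'm) \<Rightarrow> (real ^ 'm \<Rightarrow> real ^ 'm ^ 'm ^ 'm) \<Rightarrow> real ^ 'm \<Rightarrow> real"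
  where "sigma C G x = scal C G x / (2 * (real CARD('m) - 1))"

definition ricci_sym_tracefree ::
    "(real ^ 'm \<Rightarrow> real ^ 'm ^ 'm) \<Rightarrow> (real ^ 'm \<Rightarrow> real ^ 'm ^ 'm ^ 'm)
      \<Rightarrow> real ^ 'm \<Rightarrow> real ^ 'm \<Rightarrow> real ^ 'm \<Rightarrow> real"
  where "ricci_sym_tracefree C G x u v =
    (ricci G x u v + ricci G x v u) / 2 - scal C G x / real CARD('m) * form (C x) u v"

definition schouten_weyl ::
    "(real ^ 'm \<Rightarrow> real ^ 'm ^ 'm) \<Rightarrow> (real ^ 'm \<Rightarrow> real ^ 'm ^ 'm ^ 'm)
      \<Rightarrow> real ^ 'm \<Rightarrow> real ^ 'm \<Rightarrow> real ^ 'm \<Rightarrow> real"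
  where "schouten_weyl C G x u v =
    1 / (real CARD('m) - 2) * ricci_sym_tracefree C G x u v
    + 1 / real CARD('m) * sigma C G x * form (C x) u v
    - 1 / 2 * faraday G x u v"

type_synonym ('a, 'm) connection_components =
  "('a, 'm) chart \<Rightarrow> real ^ 'm \<Rightarrow> real ^ 'm ^ 'm ^ 'm"

text \<open>
  The transformation law expresses that the local covariant derivatives \<open>nabla_T (\<Gamma> \<phi>)\<close>
  define one connection on the tangent bundle; it contains the second derivative
  of the coordinate change.
\<close>

definition connection ::
    "('a, 'm::finite) chart set \<Rightarrow> ('a, 'm) connection_components \<Rightarrow> bool"
  where "connection A \<Gamma> \<longleftrightarrow>
    (\<forall>\<phi>\<in>A. smooth_on (snd \<phi> ` fst \<phi>) (\<Gamma> \<phi>)) \<and>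
    (\<forall>\<phi>1\<in>A. \<forall>\<phi>2\<in>A. \<forall>x\<in>overlap \<phi>1 \<phi>2.
       let t = transition \<phi>1 \<phi>2; J = (\<lambda>y. frechet_derivative t (at y)) in
         \<forall>u v. J x (christoffel (\<Gamma> \<phi>1 x) u v) =
               frechet_derivative (\<lambda>y. J y v) (at x) u
               + christoffel (\<Gamma> \<phi>2 (t x)) (J x u) (J x v))"

definition torsion_free ::
    "('a, 'm::finite) chart set \<Rightarrow> ('a, 'm) connection_components \<Rightarrow> bool"
  where "torsion_free A \<Gamma> \<longleftrightarrow>
    (\<forall>\<phi>\<in>A. \<forall>x\<in>snd \<phi> ` fst \<phi>. \<forall>u v.
       christoffel (\<Gamma> \<phi> x) u v = christoffel (\<Gamma> \<phi> x) v u)"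

text \<open>
  \<open>\<nabla>c = 0\<close> for \<open>c\<close> a section of \<open>S^2 T*M \<otimes> L^2\<close>: \<open>c(u,v)\<close> is differentiated as a section
  of \<open>L^2\<close>.
\<close>

definition weyl_structure ::
    "('a, 'm::finite) chart set \<Rightarrow> ('a, 'm) bilinear_components \<Rightarrow> ('a, 'm) connection_components
      \<Rightarrow> bool"
  where "weyl_structure A c \<Gamma> \<longleftrightarrow>
    connection A \<Gamma> \<and> torsion_free A \<Gamma> \<and>
    (\<forall>\<phi>\<in>A. \<forall>x\<in>snd \<phi> ` fst \<phi>. \<forall>u v w.
       nabla_L 2 (\<Gamma> \<phi>) (\<lambda>_. w) (\<lambda>y. form (c \<phi> y) u v) x
       - form (c \<phi> x) (nabla_T (\<Gamma> \<phi>) (\<lambda>_. w) (\<lambda>_. u) x) v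
       - form (c \<phi> x) u (nabla_T (\<Gamma> \<phi>) (\<lambda>_. w) (\<lambda>_. v) x) = 0)"


section \<open>Geometry of a submanifold\<close>

text \<open>
  In this section \<open>f\<close> is the inclusion of the submanifold \<open>N\<close> in coordinates, \<open>C\<close> and \<open>G\<close> are
  the components of \<open>c\<close> and \<open>\<nabla>\<close> in the ambient chart.  A vector field on \<open>N\<close> is a function
  \<open>X\<close> into \<open>real ^ 'n\<close> (it is \<open>df (X)\<close> as a section of \<open>TM|\<^sub>N\<close>), a section of \<open>TM|\<^sub>N\<close> a
  function into \<open>real ^ 'm\<close>.  All bundles \<open>L^k\<close> along \<open>N\<close> are trivialised by the ambient
  chart.
\<close>

definition df :: "(real ^ 'n \<Rightarrow> real ^ 'm) \<Rightarrow> real ^ 'n \<Rightarrow> real ^ 'n \<Rightarrow> real ^ 'm"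
  where "df f q w = frechet_derivative f (at q) w"

definition induced_conformal ::
    "(real ^ 'm \<Rightarrow> real ^ 'm ^ 'm) \<Rightarrow> (real ^ 'n \<Rightarrow> real ^ 'm) \<Rightarrow> real ^ 'n \<Rightarrow> real ^ 'n ^ 'n"
  where "induced_conformal C f q =
    (\<chi> a b. form (C (f q)) (df f q (axis a 1)) (df f q (axis b 1)))"

text \<open>The components of the orthogonal decomposition \<open>TM|\<^sub>N = TN \<oplus> \<nu>\<close>.\<close>

definition tangential_part ::
    "(real ^ 'm \<Rightarrow> real ^ 'm ^ 'm) \<Rightarrow> (real ^ 'n \<Rightarrow> real ^ 'm) \<Rightarrow> real ^ 'n \<Rightarrow> real ^ 'm \<Rightarrow> real ^ 'n"
  where "tangential_part C f q v =
    matrix_inv (induced_conformal C f q) *v (\<chi> b. form (C (f q)) v (df f q (axis b 1)))"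

definition normal_part ::
    "(real ^ 'm \<Rightarrow> real ^ 'm ^ 'm) \<Rightarrow> (real ^ 'n \<Rightarrow> real ^ 'm) \<Rightarrow> real ^ 'n \<Rightarrow> real ^ 'm \<Rightarrow> real ^ 'm"
  where "normal_part C f q v = v - df f q (tangential_part C f q v)"

definition is_normal ::
    "(real ^ 'm \<Rightarrow> real ^ 'm ^ 'm) \<Rightarrow> (real ^ 'n \<Rightarrow> real ^ 'm) \<Rightarrow> real ^ 'n \<Rightarrow> real ^ 'm \<Rightarrow> bool"
  where "is_normal C f q \<xi> \<longleftrightarrow> (\<forall>w. form (C (f q)) \<xi> (df f q w) = 0)"

text \<open>The covariant derivative of sections of \<open>TM|\<^sub>N\<close> in directions tangent to \<open>N\<close>.\<close>

definition nabla_along ::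
    "(real ^ 'm \<Rightarrow> real ^ 'm ^ 'm ^ 'm) \<Rightarrow> (real ^ 'n \<Rightarrow> real ^ 'm)
      \<Rightarrow> (real ^ 'n \<Rightarrow> real ^ 'n) \<Rightarrow> (real ^ 'n \<Rightarrow> real ^ 'm) \<Rightarrow> real ^ 'n \<Rightarrow> real ^ 'm"
  where "nabla_along G f X V q =
    frechet_derivative V (at q) (X q) + christoffel (G (f q)) (df f q (X q)) (V q)"

definition nabla_N ::
    "(real ^ 'm \<Rightarrow> real ^ 'm ^ 'm) \<Rightarrow> (real ^ 'm \<Rightarrow> real ^ 'm ^ 'm ^ 'm) \<Rightarrow> (real ^ 'n \<Rightarrow> real ^ 'm)
      \<Rightarrow> (real ^ 'n \<Rightarrow> real ^ 'n) \<Rightarrow> (real ^ 'n \<Rightarrow> real ^ 'n) \<Rightarrow> real ^ 'n \<Rightarrow> real ^ 'n"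
  where "nabla_N C G f X Y q = tangential_part C f q (nabla_along G f X (\<lambda>p. df f p (Y p)) q)"

definition nabla_perp ::
    "(real ^ 'm \<Rightarrow> real ^ 'm ^ 'm) \<Rightarrow> (real ^ 'm \<Rightarrow> real ^ 'm ^ 'm ^ 'm) \<Rightarrow> (real ^ 'n \<Rightarrow> real ^ 'm)
      \<Rightarrow> (real ^ 'n \<Rightarrow> real ^ 'n) \<Rightarrow> (real ^ 'n \<Rightarrow> real ^ 'm) \<Rightarrow> real ^ 'n \<Rightarrow> real ^ 'm"
  where "nabla_perp C G f X \<xi> q = normal_part C f q (nabla_along G f X \<xi> q)"

definition fundamental_form ::
    "(real ^ 'm \<Rightarrow> real ^ 'm ^ 'm) \<Rightarrow> (real ^ 'm \<Rightarrow> real ^ 'm ^ 'm ^ 'm) \<Rightarrow> (real ^ 'n \<Rightarrow> real ^ 'm)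
      \<Rightarrow> (real ^ 'n \<Rightarrow> real ^ 'n) \<Rightarrow> (real ^ 'n \<Rightarrow> real ^ 'n) \<Rightarrow> real ^ 'n \<Rightarrow> real ^ 'm"
  where "fundamental_form C G f X Y q = normal_part C f q (nabla_along G f X (\<lambda>p. df f p (Y p)) q)"

definition mean_curvature ::
    "(real ^ 'm \<Rightarrow> real ^ 'm ^ 'm) \<Rightarrow> (real ^ 'm \<Rightarrow> real ^ 'm ^ 'm ^ 'm) \<Rightarrow> (real ^ 'n \<Rightarrow> real ^ 'm)
      \<Rightarrow> (real ^ 'n \<Rightarrow> real ^ 'm) \<Rightarrow> real ^ 'n \<Rightarrow> real"
  where "mean_curvature C G f \<xi> q =
    - (1 / real CARD('n)) *
      (\<Sum>a\<in>UNIV. tangential_part C f q (nabla_along G f (\<lambda>_. axis a 1) \<xi> q) $ a)"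

text \<open>
  \<open>H\<close> as a section of \<open>\<nu> \<otimes> L^(-2)\<close>, i.e. the normal vector with \<open>c(H, \<xi>) = H(\<xi>)\<close>.  It is obtained
  by raising the index of the covector \<open>v \<mapsto> H(v\<^sup>\<bottom>)\<close>, which vanishes on \<open>TN\<close>; \<open>v\<close> runs through
  the coordinate frame, since \<open>mean_curvature\<close> takes sections as arguments.
\<close>

definition mean_curvature_vector ::
    "(real ^ 'm \<Rightarrow> real ^ 'm ^ 'm) \<Rightarrow> (real ^ 'm \<Rightarrow> real ^ 'm ^ 'm ^ 'm) \<Rightarrow> (real ^ 'n \<Rightarrow> real ^ 'm)
      \<Rightarrow> real ^ 'n \<Rightarrow> real ^ 'm"
  where "mean_curvature_vector C G f q =
    matrix_inv (C (f q)) *v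
      (\<chi> i. mean_curvature C G f (\<lambda>p. normal_part C f p (axis i 1)) q)"

definition B0 ::
    "(real ^ 'm \<Rightarrow> real ^ 'm ^ 'm) \<Rightarrow> (real ^ 'm \<Rightarrow> real ^ 'm ^ 'm ^ 'm) \<Rightarrow> (real ^ 'n \<Rightarrow> real ^ 'm)
      \<Rightarrow> (real ^ 'n \<Rightarrow> real ^ 'n) \<Rightarrow> (real ^ 'n \<Rightarrow> real ^ 'n) \<Rightarrow> real ^ 'n \<Rightarrow> real ^ 'm"
  where "B0 C G f X Y q =
    fundamental_form C G f X Y q
    - form (induced_conformal C f q) (X q) (Y q) *\<^sub>R mean_curvature_vector C G f q"

definition nabla_B0 ::
    "(real ^ 'm \<Rightarrow> real ^ 'm ^ 'm) \<Rightarrow> (real ^ 'm \<Rightarrow> real ^ 'm ^ 'm ^ 'm) \<Rightarrow> (real ^ 'n \<Rightarrow> real ^ 'm)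
      \<Rightarrow> (real ^ 'n \<Rightarrow> real ^ 'n) \<Rightarrow> (real ^ 'n \<Rightarrow> real ^ 'n) \<Rightarrow> (real ^ 'n \<Rightarrow> real ^ 'n)
      \<Rightarrow> real ^ 'n \<Rightarrow> real ^ 'm"
  where "nabla_B0 C G f Z X Y q =
    nabla_perp C G f Z (B0 C G f X Y) q
    - B0 C G f (nabla_N C G f Z X) Y q
    - B0 C G f X (nabla_N C G f Z Y) q"

text \<open>\<open>\<delta>B\<^sub>0\<close> with values in \<open>\<nu> \<otimes> L^(-2)\<close>.\<close>

definition delta_B0 ::
    "(real ^ 'm \<Rightarrow> real ^ 'm ^ 'm) \<Rightarrow> (real ^ 'm \<Rightarrow> real ^ 'm ^ 'm ^ 'm) \<Rightarrow> (real ^ 'n \<Rightarrow> real ^ 'm)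
      \<Rightarrow> (real ^ 'n \<Rightarrow> real ^ 'n) \<Rightarrow> real ^ 'n \<Rightarrow> real ^ 'm"
  where "delta_B0 C G f X q =
    (\<Sum>a\<in>UNIV. \<Sum>b\<in>UNIV. matrix_inv (induced_conformal C f q) $ a $ b *\<^sub>R
       nabla_B0 C G f (\<lambda>_. axis a 1) X (\<lambda>_. axis b 1) q)"

definition nabla_mean_curvature ::
    "(real ^ 'm \<Rightarrow> real ^ 'm ^ 'm) \<Rightarrow> (real ^ 'm \<Rightarrow> real ^ 'm ^ 'm ^ 'm) \<Rightarrow> (real ^ 'n \<Rightarrow> real ^ 'm)
      \<Rightarrow> (real ^ 'n \<Rightarrow> real ^ 'n) \<Rightarrow> (real ^ 'n \<Rightarrow> real ^ 'm) \<Rightarrow> real ^ 'n \<Rightarrow> real"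
  where "nabla_mean_curvature C G f X \<xi> q =
    frechet_derivative (mean_curvature C G f \<xi>) (at q) (X q)
    - mean_curvature C G f (nabla_perp C G f X \<xi>) q"

text \<open>
  \<open>\<mu>\<^sub>X(\<xi>)\<close> for local sections \<open>X\<close> of \<open>TN\<close> and \<open>\<xi>\<close> of \<open>\<nu>\<close>.  In the last summand the
  identification \<open>\<nu> \<otimes> L^(-2) \<cong> \<nu>*\<close> is pairing by \<open>c\<close>.
\<close>

definition mixed_schouten_weyl ::
    "(real ^ 'm \<Rightarrow> real ^ 'm ^ 'm) \<Rightarrow> (real ^ 'm \<Rightarrow> real ^ 'm ^ 'm ^ 'm) \<Rightarrow> (real ^ 'n \<Rightarrow> real ^ 'm)
      \<Rightarrow> (real ^ 'n \<Rightarrow> real ^ 'n) \<Rightarrow> (real ^ 'n \<Rightarrow> real ^ 'm) \<Rightarrow> real ^ 'n \<Rightarrow> real"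
  where "mixed_schouten_weyl C G f X \<xi> q =
    schouten_weyl C G (f q) (df f q (X q)) (\<xi> q)
    - nabla_mean_curvature C G f X \<xi> q
    + 1 / (real CARD('n) - 1) * form (C (f q)) (delta_B0 C G f X q) (\<xi> q)"

end

theory Submission
  imports Defs
begin

text \<open>
  At a point of \<open>N\<close> write \<open>e\<^sub>a\<close> for the coordinate frame of \<open>TN\<close> and \<open>g\<close> for the induced structure.
  Since \<open>B = H c + B\<^sub>0\<close> and \<open>\<nabla>c = 0\<close>, tracing the Codazzi equation gives
  \<open>(n - 1) (- \<nabla>\<^sub>XH + \<delta>B\<^sub>0(X) / (n - 1))(\<xi>) = \<Sum> g\<^sup>a\<^sup>b c(R(e\<^sub>a, X) e\<^sub>b, \<xi>)\<close>.  The curvature is skew up to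
  the term \<open>2 F c\<close>, so the right-hand side is minus the tangential part of the trace defining
  \<open>Ric(X, \<xi>)\<close>.  In codimension one the only missing direction is \<open>\<xi>\<close> itself, which contributes
  \<open>F(\<xi>, X)\<close>, and \<open>(m - 2) h(X, \<xi>) = Ric(X, \<xi>) + F(X, \<xi>)\<close> because the skew part of \<open>Ric\<close> is
  \<open>- (m / 2) F\<close>.  As \<open>m - 2 = n - 1\<close>, everything cancels.
\<close>

section \<open>Directional derivatives of smooth maps\<close>

text \<open>The obstacle is that \<open>nabla_mean_curvature\<close> and \<open>nabla_B0\<close>
  differentiate orthogonal projections and take sections as arguments, so tensoriality has to be
  shown as well. Both are met by keeping vectors unprojected: the ambient derivatives of the frame
  fields (\<open>hess\<close>) and their metric trace (\<open>mean_hess\<close>) are differentiated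
  as they stand, and pairing with a normal vector comes last. The tangential part of such a vector
  then contributes only through the second fundamental form, which is where the terms with
  \<open>tang\<close> come from; derivatives of \<open>\<xi>\<close> cancel by the Weingarten
  relation, those of \<open>X\<close> by the Leibniz rule.

  The structure \<open>c\<close> and its inverse are parallel only with weights 2 and -2, so in the
  trivialisation by the ambient chart each differentiation brings in twice the connection form of
  \<open>L\<close>: hence the \<open>weight\<close> terms and the 2 in the curvature identity. The
  factor m / 2 in the skew part of Ric comes from the first Bianchi identity, since the trace of
  R(u, v) is m F(u, v). The multiples of \<open>c\<close> in h vanish on (X, \<open>\<xi>\<close>)
  by orthogonality.\<close>

lemma Ck_on_subset: "Ck_on k S f \<Longrightarrow> S' \<subseteq> S \<Longrightarrow> Ck_on k S' f"
  by (induction k arbitrary: f) (auto intro: continuous_on_subset)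

lemma smooth_on_subset: "smooth_on S f \<Longrightarrow> S' \<subseteq> S \<Longrightarrow> smooth_on S' f"
  unfolding smooth_on_def using Ck_on_subset by blast

lemma smooth_on_differentiable: "smooth_on S f \<Longrightarrow> x \<in> S \<Longrightarrow> f differentiable (at x)"
  unfolding smooth_on_def by (metis Ck_on.simps(2))

lemma smooth_on_continuous_on: "smooth_on S f \<Longrightarrow> continuous_on S f"
  unfolding smooth_on_def by (metis Ck_on.simps(1))

lemma smooth_on_frechet_derivative:
  "smooth_on S f \<Longrightarrow> smooth_on S (\<lambda>x. frechet_derivative f (at x) v)"
  unfolding smooth_on_def by (metis Ck_on.simps(2))

lemma linear_frechet_derivative_at:
  "f differentiable (at x) \<Longrightarrow> linear (frechet_derivative f (at x))"
  using frechet_derivative_works has_derivative_linear by blast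

lemma frechet_derivative_eq:
  "(f has_derivative f') (at x) \<Longrightarrow> frechet_derivative f (at x) v = f' v"
  using frechet_derivative_at by metis

lemma frechet_derivative_cong_open:
  assumes "open S" "p \<in> S" "\<And>x. x \<in> S \<Longrightarrow> f x = g x" "g differentiable (at p)"
  shows "frechet_derivative f (at p) = frechet_derivative g (at p)"
  using frechet_derivative_transform_within_open[OF assms(4,1,2)] assms(3) by metis

lemma differentiable_cong_open:
  assumes "open S" "p \<in> S" "\<And>x. x \<in> S \<Longrightarrow> f x = g x" "g differentiable (at p)"
  shows "f differentiable (at p)"
  using assms has_derivative_transform_within_open[of g _ p UNIV S f]
  unfolding differentiable_def by metis

text \<open>The mean value theorem is used twice: in the direction \<open>u\<close> on a difference
  in the direction \<open>v\<close>, then in the direction \<open>v\<close> on the derivative. The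
  second difference is symmetric in \<open>u\<close> and \<open>v\<close>, which ties the two mixed
  derivatives together.\<close>

lemma second_difference_mvt:
  fixes F :: "'e::real_normed_vector \<Rightarrow> real"
  assumes t: "t > 0"
    and rectangle: "\<And>r s. 0 \<le> r \<Longrightarrow> r \<le> t \<Longrightarrow> 0 \<le> s \<Longrightarrow> s \<le> t \<Longrightarrow> x + r *\<^sub>R u + s *\<^sub>R v \<in> S"
    and F1: "\<And>y. y \<in> S \<Longrightarrow> F differentiable (at y)"
    and F2: "\<And>y. y \<in> S \<Longrightarrow> (\<lambda>y. frechet_derivative F (at y) u) differentiable (at y)"
  obtains r s where "0 < r" "r < t" "0 < s" "s < t"
    "F (x + t *\<^sub>R u + t *\<^sub>R v) - F (x + t *\<^sub>R u) - F (x + t *\<^sub>R v) + F x =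
      t * t * frechet_derivative (\<lambda>y. frechet_derivative F (at y) u) (at (x + r *\<^sub>R u + s *\<^sub>R v)) v"
proof -
  define F' where "F' = (\<lambda>y. frechet_derivative F (at y) u)"
  have dF: "((\<lambda>r. F (x + r *\<^sub>R u + s *\<^sub>R v)) has_real_derivative F' (x + r *\<^sub>R u + s *\<^sub>R v)) (at r)"
    if "0 \<le> r" "r \<le> t" "0 \<le> s" "s \<le> t" for r s
  proof -
    let ?D = "frechet_derivative F (at (x + r *\<^sub>R u + s *\<^sub>R v))"
    have D: "(F has_derivative ?D) (at (x + r *\<^sub>R u + s *\<^sub>R v))"
      using F1[OF rectangle[OF that]] frechet_derivative_works by blast
    have "((\<lambda>r. F (x + r *\<^sub>R u + s *\<^sub>R v)) has_derivative (\<lambda>h. ?D (h *\<^sub>R u))) (at r)"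
      by (rule has_derivative_compose[where g = F and f = "\<lambda>r. x + r *\<^sub>R u + s *\<^sub>R v"])
        (auto intro!: derivative_eq_intros D)
    moreover have "?D (h *\<^sub>R u) = F' (x + r *\<^sub>R u + s *\<^sub>R v) * h" for h
      using linear_scale[OF has_derivative_linear[OF D]] by (simp add: F'_def)
    ultimately show ?thesis by (simp add: has_field_derivative_def)
  qed
  have dF': "((\<lambda>s. F' (x + r *\<^sub>R u + s *\<^sub>R v)) has_real_derivative
      frechet_derivative F' (at (x + r *\<^sub>R u + s *\<^sub>R v)) v) (at s)"
    if "0 \<le> r" "r \<le> t" "0 \<le> s" "s \<le> t" for r s
  proof -
    let ?D = "frechet_derivative F' (at (x + r *\<^sub>R u + s *\<^sub>R v))"
    have D: "(F' has_derivative ?D) (at (x + r *\<^sub>R u + s *\<^sub>R v))"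
      using F2[OF rectangle[OF that]] frechet_derivative_works unfolding F'_def by blast
    have "((\<lambda>s. F' (x + r *\<^sub>R u + s *\<^sub>R v)) has_derivative (\<lambda>h. ?D (h *\<^sub>R v))) (at s)"
      by (rule has_derivative_compose[where g = F' and f = "\<lambda>s. x + r *\<^sub>R u + s *\<^sub>R v"])
        (auto intro!: derivative_eq_intros D)
    moreover have "?D (h *\<^sub>R v) = ?D v * h" for h
      using linear_scale[OF has_derivative_linear[OF D]] by simp
    ultimately show ?thesis by (simp add: has_field_derivative_def)
  qed
  define \<phi> where "\<phi> = (\<lambda>r. F (x + r *\<^sub>R u + t *\<^sub>R v) - F (x + r *\<^sub>R u + 0 *\<^sub>R v))"
  have "\<exists>r>0. r < t \<and> \<phi> t - \<phi> 0 =
      (t - 0) * (F' (x + r *\<^sub>R u + t *\<^sub>R v) - F' (x + r *\<^sub>R u + 0 *\<^sub>R v))"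
    unfolding \<phi>_def by (rule MVT2[OF t]) (intro DERIV_diff dF; use t in simp)
  then obtain r where r: "0 < r" "r < t"
    "\<phi> t - \<phi> 0 = t * (F' (x + r *\<^sub>R u + t *\<^sub>R v) - F' (x + r *\<^sub>R u + 0 *\<^sub>R v))"
    by auto
  have "\<exists>s>0. s < t \<and> F' (x + r *\<^sub>R u + t *\<^sub>R v) - F' (x + r *\<^sub>R u + 0 *\<^sub>R v) =
      (t - 0) * frechet_derivative F' (at (x + r *\<^sub>R u + s *\<^sub>R v)) v"
    by (rule MVT2[OF t]) (use r in \<open>intro dF'; simp\<close>)
  then obtain s where s: "0 < s" "s < t"
    "F' (x + r *\<^sub>R u + t *\<^sub>R v) - F' (x + r *\<^sub>R u + 0 *\<^sub>R v) =
      t * frechet_derivative F' (at (x + r *\<^sub>R u + s *\<^sub>R v)) v"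
    by auto
  show thesis
    using that[OF r(1,2) s(1,2)] r(3) s(3) unfolding \<phi>_def F'_def by (simp add: algebra_simps)
qed

text \<open>Both orders of differentiation compute the same second difference over a small
  parallelogram, so by continuity they cannot differ at its corner.\<close>

lemma second_derivative_symmetric_real:
  fixes F :: "'e::real_normed_vector \<Rightarrow> real"
  assumes S: "open S" "x \<in> S" and F: "smooth_on S F"
  shows "frechet_derivative (\<lambda>y. frechet_derivative F (at y) u) (at x) v =
    frechet_derivative (\<lambda>y. frechet_derivative F (at y) v) (at x) u" (is "?a x = ?b x")
proof (rule ccontr)
  assume ne: "?a x \<noteq> ?b x"
  define e where "e = \<bar>?a x - ?b x\<bar> / 2"
  have e: "e > 0" using ne by (simp add: e_def)
  have "continuous_on S (\<lambda>x. ?a x)" "continuous_on S (\<lambda>x. ?b x)"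
    by (rule smooth_on_continuous_on, rule smooth_on_frechet_derivative,
        rule smooth_on_frechet_derivative, rule F)+
  hence "continuous (at x) ?a" "continuous (at x) ?b"
    using S continuous_on_eq_continuous_at by blast+
  then obtain d1 d2 where
      d1: "d1 > 0" "\<And>y. dist y x < d1 \<Longrightarrow> dist (?a y) (?a x) < e" and
      d2: "d2 > 0" "\<And>y. dist y x < d2 \<Longrightarrow> dist (?b y) (?b x) < e"
    using e unfolding continuous_within_eps_delta by (metis UNIV_I)
  obtain d3 where d3: "d3 > 0" "ball x d3 \<subseteq> S" using S open_contains_ball by blast
  define d where "d = min d1 (min d2 d3)"
  have d: "d > 0" "d \<le> d1" "d \<le> d2" "d \<le> d3" using d1 d2 d3 by (auto simp: d_def)
  define b where "b = norm u + norm v + 1"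
  have b: "b > 0" "norm u + norm v \<le> b"
    unfolding b_def by (simp_all add: add_nonneg_pos)
  \<comment> \<open>With this side length the parallelogram stays in the ball of radius
    \<open>d\<close>; the summand 1 in \<open>b\<close> avoids division by zero when both directions
    vanish.\<close>
  define t where "t = d / (2 * b)"
  have t: "t > 0" "t * b < d" using d b by (simp_all add: t_def)
  have near: "dist (x + r *\<^sub>R w + s *\<^sub>R z) x < d"
    if "0 \<le> r" "r \<le> t" "0 \<le> s" "s \<le> t" "norm w + norm z \<le> norm u + norm v" for r s and w z :: 'e
  proof -
    have "norm (r *\<^sub>R w + s *\<^sub>R z) \<le> r * norm w + s * norm z"
      using that by (metis norm_triangle_le norm_scaleR abs_of_nonneg order_refl)
    also have "\<dots> \<le> t * norm w + t * norm z"
      using that by (intro add_mono mult_right_mono) auto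
    also have "\<dots> = t * (norm w + norm z)" by (simp add: algebra_simps)
    also have "\<dots> \<le> t * b" using t(1) b(2) that(5) by (intro mult_left_mono) linarith+
    also note t(2)
    finally show ?thesis by (simp add: dist_norm add.assoc)
  qed
  have inS: "y \<in> S" if "dist y x < d" for y
    using that d d3 by (auto simp: subset_iff dist_commute)
  have F1: "F differentiable (at y)" "(\<lambda>y. frechet_derivative F (at y) w) differentiable (at y)"
    if "y \<in> S" for y w
    using F that by (auto intro: smooth_on_differentiable smooth_on_frechet_derivative)
  obtain r s where rs: "0 < r" "r < t" "0 < s" "s < t"
    "F (x + t *\<^sub>R u + t *\<^sub>R v) - F (x + t *\<^sub>R u) - F (x + t *\<^sub>R v) + F x =
      t * t * ?a (x + r *\<^sub>R u + s *\<^sub>R v)"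
    by (rule second_difference_mvt[of t x u v S F]) (use t(1) near F1 inS in auto)
  obtain r' s' where rs': "0 < r'" "r' < t" "0 < s'" "s' < t"
    "F (x + t *\<^sub>R v + t *\<^sub>R u) - F (x + t *\<^sub>R v) - F (x + t *\<^sub>R u) + F x =
      t * t * ?b (x + r' *\<^sub>R v + s' *\<^sub>R u)"
    by (rule second_difference_mvt[of t x v u S F]) (use t(1) near F1 inS in auto)
  have "t * t * ?a (x + r *\<^sub>R u + s *\<^sub>R v) = t * t * ?b (x + r' *\<^sub>R v + s' *\<^sub>R u)"
    using rs(5) rs'(5) by (simp add: algebra_simps)
  \<comment> \<open>The two mean value points differ, but at both of them the derivative in question
    is within half the gap of its value at \<open>x\<close>.\<close>
  hence eq: "?a (x + r *\<^sub>R u + s *\<^sub>R v) = ?b (x + r' *\<^sub>R v + s' *\<^sub>R u)"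
    using t(1) by simp
  have "dist (?a (x + r *\<^sub>R u + s *\<^sub>R v)) (?a x) < e" "dist (?b (x + r' *\<^sub>R v + s' *\<^sub>R u)) (?b x) < e"
    using rs rs' d near by (auto intro!: d1(2) d2(2) less_le_trans[OF near])
  hence "dist (?a x) (?b x) < \<bar>?a x - ?b x\<bar>"
    unfolding e_def eq by (rule dist_triangle_half_r)
  thus False by (simp add: dist_real_def)
qed

lemma frechet_derivative_bounded_linear:
  assumes "bounded_linear L" "f differentiable (at x)"
  shows "frechet_derivative (\<lambda>x. L (f x)) (at x) v = L (frechet_derivative f (at x) v)"
  by (rule frechet_derivative_eq[OF bounded_linear.has_derivative[OF assms(1)]])
    (use assms(2) frechet_derivative_works in blast)

lemma differentiable_bounded_linear:
  assumes "bounded_linear L" "f differentiable (at x)"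
  shows "(\<lambda>x. L (f x)) differentiable (at x)"
  using assms bounded_linear.has_derivative unfolding differentiable_def by blast

text \<open>Openness lets agreement on \<open>S\<close> pass to the derivatives, which
  \<open>Ck_on\<close> takes of the total functions.\<close>

lemma Ck_on_cong:
  assumes "open S" "\<And>x. x \<in> S \<Longrightarrow> f x = g x" "Ck_on k S g"
  shows "Ck_on k S f"
  using assms(2,3)
proof (induction k arbitrary: f g)
  case 0 then show ?case using continuous_on_cong by (metis Ck_on.simps(1))
next
  case (Suc k)
  have "Ck_on k S (\<lambda>x. frechet_derivative f (at x) v)" for v
    by (rule Suc.IH[where g = "\<lambda>x. frechet_derivative g (at x) v"])
      (use Suc.prems frechet_derivative_cong_open[OF assms(1) _ Suc.prems(1)] in auto)
  then show ?case using Suc.prems differentiable_cong_open[OF assms(1) _ Suc.prems(1)] by auto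
qed

lemma smooth_on_bounded_linear:
  assumes "open S" "bounded_linear L" "smooth_on S f"
  shows "smooth_on S (\<lambda>x. L (f x))"
proof -
  have "Ck_on k S f \<Longrightarrow> Ck_on k S (\<lambda>x. L (f x))" for k
  proof (induction k arbitrary: f)
    case 0 then show ?case
      using bounded_linear.continuous_on[OF assms(2)] by auto
  next
    case (Suc k)
    have "Ck_on k S (\<lambda>x. frechet_derivative (\<lambda>x. L (f x)) (at x) v)" for v
      by (rule Ck_on_cong[OF assms(1) frechet_derivative_bounded_linear[OF assms(2)]])
        (use Suc in auto)
    then show ?case using Suc.prems differentiable_bounded_linear[OF assms(2)] by auto
  qed
  thus ?thesis using assms(3) by (auto simp: smooth_on_def)
qed

lemma second_derivative_symmetric:
  fixes F :: "'e::real_normed_vector \<Rightarrow> 'f::euclidean_space"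
  assumes S: "open S" "x \<in> S" and F: "smooth_on S F"
  shows "frechet_derivative (\<lambda>y. frechet_derivative F (at y) u) (at x) v =
    frechet_derivative (\<lambda>y. frechet_derivative F (at y) v) (at x) u"
proof (rule euclidean_eqI)
  fix b :: 'f assume "b \<in> Basis"
  have L: "bounded_linear (\<lambda>z. z \<bullet> b)" by (rule bounded_linear_inner_left)
  have *: "frechet_derivative (\<lambda>y. frechet_derivative F (at y) u) (at x) v \<bullet> b =
      frechet_derivative (\<lambda>y. frechet_derivative (\<lambda>y. F y \<bullet> b) (at y) u) (at x) v" for u v
  proof -
    have "frechet_derivative (\<lambda>y. frechet_derivative F (at y) u) (at x) v \<bullet> b =
        frechet_derivative (\<lambda>y. frechet_derivative F (at y) u \<bullet> b) (at x) v"
      by (rule frechet_derivative_bounded_linear[OF L, symmetric])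
        (use F S smooth_on_differentiable smooth_on_frechet_derivative in blast)
    also have "frechet_derivative (\<lambda>y. frechet_derivative F (at y) u \<bullet> b) (at x) =
        frechet_derivative (\<lambda>y. frechet_derivative (\<lambda>y. F y \<bullet> b) (at y) u) (at x)"
      by (rule frechet_derivative_cong_open[OF S])
        (use F S in \<open>auto intro!: frechet_derivative_bounded_linear[OF L, symmetric]
          smooth_on_differentiable[of S] smooth_on_frechet_derivative smooth_on_bounded_linear[OF S(1) L]\<close>)
    finally show ?thesis .
  qed
  show "frechet_derivative (\<lambda>y. frechet_derivative F (at y) u) (at x) v \<bullet> b =
      frechet_derivative (\<lambda>y. frechet_derivative F (at y) v) (at x) u \<bullet> b"
    unfolding * by (rule second_derivative_symmetric_real[OF S smooth_on_bounded_linear[OF S(1) L F]])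
qed

section \<open>Derivatives of bilinear expressions and of the inverse matrix\<close>

lemma vec_axis_sum: "(v :: real^'k) = (\<Sum>i\<in>UNIV. v $ i *\<^sub>R axis i 1)"
  using basis_expansion[of v] by (simp add: scalar_mult_eq_scaleR)

lemma bounded_bilinear_matrix_vector_mult:
  "bounded_bilinear ((*v) :: real^'n^'m \<Rightarrow> real^'n \<Rightarrow> real^'m)"
  unfolding bilinear_conv_bounded_bilinear[symmetric] bilinear_def
  by (auto intro!: linearI simp: matrix_vector_mult_add_rdistrib scaleR_matrix_vector_assoc
      matrix_vector_right_distrib vec.scale matrix_vector_mult_scaleR)

lemma form_bilinear:
  "form A (u + u') v = form A u v + form A u' v"
  "form A (u - u') v = form A u v - form A u' v"
  "form A (r *\<^sub>R u) v = r * form A u v"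
  "form A 0 v = 0"
  "form A (\<Sum>i\<in>I. h i) v = (\<Sum>i\<in>I. form A (h i) v)"
  "form A u (v + v') = form A u v + form A u v'"
  "form A u (v - v') = form A u v - form A u v'"
  "form A u (r *\<^sub>R v) = r * form A u v"
  "form A u 0 = 0"
  "form A u (\<Sum>i\<in>I. h i) = (\<Sum>i\<in>I. form A u (h i))"
  by (simp_all add: form_def inner_left_distrib inner_diff_left inner_right_distrib inner_diff_right
      matrix_vector_right_distrib matrix_vector_mult_diff_distrib matrix_vector_mult_scaleR
      inner_sum_left inner_sum_right linear_sum[OF matrix_vector_mul_linear])

lemma form_commute: "transpose A = A \<Longrightarrow> form A u v = form A v u"
  by (metis form_def dot_lmul_matrix inner_commute vector_transpose_matrix)

lemma form_nondegenerate:
  assumes "\<And>v. form A u v = 0" "\<And>u. u \<noteq> 0 \<Longrightarrow> form A u u > 0" shows "u = 0"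
  using assms by (metis less_irrefl)

lemma has_derivative_form:
  assumes "(A has_derivative A') (at x)" "(u has_derivative u') (at x)" "(v has_derivative v') (at x)"
  shows "((\<lambda>x. form (A x) (u x) (v x)) has_derivative
    (\<lambda>h. form (A' h) (u x) (v x) + form (A x) (u' h) (v x) + form (A x) (u x) (v' h))) (at x)"
  unfolding form_def
  by (rule has_derivative_eq_rhs[OF has_derivative_inner[OF assms(2)
        bounded_bilinear.FDERIV[OF bounded_bilinear_matrix_vector_mult assms(1,3)]]])
    (simp add: inner_right_distrib algebra_simps)

lemma differentiable_form:
  assumes "A differentiable (at x)" "u differentiable (at x)" "v differentiable (at x)"
  shows "(\<lambda>x. form (A x) (u x) (v x)) differentiable (at x)"
  using assms has_derivative_form unfolding differentiable_def by blast

lemma frechet_derivative_form: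
  assumes "A differentiable (at x)" "u differentiable (at x)" "v differentiable (at x)"
  shows "frechet_derivative (\<lambda>x. form (A x) (u x) (v x)) (at x) h =
    form (frechet_derivative A (at x) h) (u x) (v x) + form (A x) (frechet_derivative u (at x) h) (v x)
    + form (A x) (u x) (frechet_derivative v (at x) h)"
  by (rule frechet_derivative_eq[OF has_derivative_form])
    (use assms frechet_derivative_works in blast)+

text \<open>The connection form evaluated on \<open>u\<close>, as an endomorphism: the product rule
  for matrices and the symmetry of the trace of a product become available.\<close>

definition christoffel_matrix :: "real^'m^'m^'m \<Rightarrow> real^'m \<Rightarrow> real^'m^'m"
  where "christoffel_matrix g u = (\<chi> k j. \<Sum>i\<in>UNIV. g $ k $ i $ j * u $ i)"

lemma christoffel_conv_matrix: "christoffel g u v = christoffel_matrix g u *v v"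
proof -
  have "(\<Sum>i\<in>UNIV. \<Sum>j\<in>UNIV. g $ k $ i $ j * u $ i * v $ j) =
      (\<Sum>j\<in>UNIV. (\<Sum>i\<in>UNIV. g $ k $ i $ j * u $ i) * v $ j)" for k
    by (subst sum.swap) (simp add: sum_distrib_right)
  thus ?thesis
    by (simp add: christoffel_def christoffel_matrix_def matrix_vector_mult_def vec_eq_iff)
qed

lemma bounded_bilinear_christoffel_matrix: "bounded_bilinear (christoffel_matrix :: real^'m^'m^'m \<Rightarrow> _)"
  unfolding bilinear_conv_bounded_bilinear[symmetric] bilinear_def
  by (auto intro!: linearI simp: christoffel_matrix_def vec_eq_iff algebra_simps sum.distrib
      sum_distrib_left)

lemma has_derivative_christoffel:
  assumes "(g has_derivative g') (at x)" "(u has_derivative u') (at x)" "(v has_derivative v') (at x)"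
  shows "((\<lambda>x. christoffel (g x) (u x) (v x)) has_derivative
    (\<lambda>h. christoffel (g' h) (u x) (v x) + christoffel (g x) (u' h) (v x)
      + christoffel (g x) (u x) (v' h))) (at x)"
  unfolding christoffel_conv_matrix
  by (rule has_derivative_eq_rhs[OF bounded_bilinear.FDERIV[OF bounded_bilinear_matrix_vector_mult
        bounded_bilinear.FDERIV[OF bounded_bilinear_christoffel_matrix assms(1,2)] assms(3)]])
    (simp add: matrix_vector_mult_add_rdistrib algebra_simps)

lemma differentiable_christoffel:
  assumes "g differentiable (at x)" "u differentiable (at x)" "v differentiable (at x)"
  shows "(\<lambda>x. christoffel (g x) (u x) (v x)) differentiable (at x)"
  using assms has_derivative_christoffel unfolding differentiable_def by blast

lemma frechet_derivative_christoffel: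
  assumes "g differentiable (at x)" "u differentiable (at x)" "v differentiable (at x)"
  shows "frechet_derivative (\<lambda>x. christoffel (g x) (u x) (v x)) (at x) h =
    christoffel (frechet_derivative g (at x) h) (u x) (v x)
    + christoffel (g x) (frechet_derivative u (at x) h) (v x)
    + christoffel (g x) (u x) (frechet_derivative v (at x) h)"
  by (rule frechet_derivative_eq[OF has_derivative_christoffel])
    (use assms frechet_derivative_works in blast)+

lemma christoffel_bilinear:
  "christoffel g (u + u') v = christoffel g u v + christoffel g u' v"
  "christoffel g (u - u') v = christoffel g u v - christoffel g u' v"
  "christoffel g (r *\<^sub>R u) v = r *\<^sub>R christoffel g u v"
  "christoffel g 0 v = 0"
  "christoffel g (\<Sum>i\<in>I. h i) v = (\<Sum>i\<in>I. christoffel g (h i) v)"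
  "christoffel g u (v + v') = christoffel g u v + christoffel g u v'"
  "christoffel g u (v - v') = christoffel g u v - christoffel g u v'"
  "christoffel g u (r *\<^sub>R v) = r *\<^sub>R christoffel g u v"
  "christoffel g u 0 = 0"
  "christoffel g u (\<Sum>i\<in>I. h i) = (\<Sum>i\<in>I. christoffel g u (h i))"
proof -
  interpret M: bounded_bilinear "christoffel g"
    unfolding bilinear_conv_bounded_bilinear[symmetric] bilinear_def
    by (auto intro!: linearI simp: christoffel_def vec_eq_iff algebra_simps sum.distrib
        sum_distrib_left)
  show
    "christoffel g (u + u') v = christoffel g u v + christoffel g u' v"
    "christoffel g (u - u') v = christoffel g u v - christoffel g u' v"
    "christoffel g (r *\<^sub>R u) v = r *\<^sub>R christoffel g u v"
    "christoffel g 0 v = 0"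
    "christoffel g (\<Sum>i\<in>I. h i) v = (\<Sum>i\<in>I. christoffel g (h i) v)"
    "christoffel g u (v + v') = christoffel g u v + christoffel g u v'"
    "christoffel g u (v - v') = christoffel g u v - christoffel g u v'"
    "christoffel g u (r *\<^sub>R v) = r *\<^sub>R christoffel g u v"
    "christoffel g u 0 = 0"
    "christoffel g u (\<Sum>i\<in>I. h i) = (\<Sum>i\<in>I. christoffel g u (h i))"
    by (rule M.add_left M.diff_left M.scaleR_left M.zero_left M.sum_left
        M.add_right M.diff_right M.scaleR_right M.zero_right M.sum_right)+
qed

lemma differentiable_vec:
  fixes V :: "'a::real_normed_vector \<Rightarrow> real^'k"
  assumes "\<And>i. (\<lambda>p. V p $ i) differentiable (at p)"
  shows "V differentiable (at p)"
proof -
  have "V = (\<lambda>p. \<Sum>i\<in>UNIV. V p $ i *\<^sub>R axis i 1)"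
    by (rule ext, rule vec_axis_sum)
  moreover have "(\<lambda>p. \<Sum>i\<in>UNIV. V p $ i *\<^sub>R (axis i 1 :: real^'k)) differentiable (at p)"
    using assms by (intro differentiable_sum ballI differentiable_scaleR) auto
  ultimately show ?thesis by simp
qed

section \<open>Differentiability of determinants and inverse matrices\<close>

lemma differentiable_prod:
  fixes f :: "'i \<Rightarrow> 'a::real_normed_vector \<Rightarrow> real"
  assumes "\<And>i. i \<in> I \<Longrightarrow> f i differentiable (at x)"
  shows "(\<lambda>x. \<Prod>i\<in>I. f i x) differentiable (at x)"
  using assms by (induction I rule: infinite_finite_induct) auto

lemma differentiable_det:
  fixes A :: "'a::real_normed_vector \<Rightarrow> real^'n^'n"
  assumes "\<And>i j. (\<lambda>x. A x $ i $ j) differentiable (at x)"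
  shows "(\<lambda>x. det (A x)) differentiable (at x)"
proof -
  have "(\<lambda>x. \<Prod>i\<in>UNIV. A x $ i $ p i) differentiable (at x)" for p
    by (rule differentiable_prod) (rule assms)
  thus ?thesis
    unfolding det_def by (intro differentiable_sum differentiable_mult) (auto simp: finite_permutations)
qed

lemma
  fixes A :: "real^'n^'n"
  assumes "invertible A"
  shows times_matrix_inv_self: "A ** matrix_inv A = mat 1"
    and matrix_inv_times_self: "matrix_inv A ** A = mat 1"
proof -
  have "A ** matrix_inv A = mat 1 \<and> matrix_inv A ** A = mat 1"
    unfolding matrix_inv_def by (rule someI_ex) (use assms in \<open>simp add: invertible_def\<close>)
  thus "A ** matrix_inv A = mat 1" "matrix_inv A ** A = mat 1" by auto
qed

text \<open>Cramer's rule, applied to the columns of the inverse. It shows the entries of the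
  inverse as quotients of determinants, hence as differentiable functions.\<close>

lemma matrix_inv_cofactor:
  fixes A :: "real^'n^'n"
  assumes "invertible A"
  shows "matrix_inv A $ k $ l = det (\<chi> i j. if j = k then axis l 1 $ i else A $ i $ j) / det A"
proof -
  have "A *v (matrix_inv A *v axis l 1) = axis l 1"
    using assms by (simp add: matrix_vector_mul_assoc times_matrix_inv_self)
  hence "matrix_inv A *v axis l 1 =
      (\<chi> k. det (\<chi> i j. if j = k then axis l 1 $ i else A $ i $ j) / det A)"
    using assms by (subst (asm) cramer) (auto simp: invertible_det_nz)
  moreover have "matrix_inv A $ k $ l = (matrix_inv A *v axis l 1) $ k"
    by (simp add: matrix_vector_mult_basis column_def)
  ultimately show ?thesis by simp
qed

lemma differentiable_matrix_inv:
  fixes A :: "'a::real_normed_vector \<Rightarrow> real^'n^'n"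
  assumes "open S" "x \<in> S" "\<And>x. x \<in> S \<Longrightarrow> invertible (A x)"
    "\<And>i j. (\<lambda>x. A x $ i $ j) differentiable (at x)"
  shows "(\<lambda>x. matrix_inv (A x) $ k $ l) differentiable (at x)"
proof (rule differentiable_cong_open[OF assms(1,2) matrix_inv_cofactor[OF assms(3)]])
  have "(\<lambda>x. (if j = k then axis l 1 $ i else A x $ i $ j)) differentiable (at x)" for i j
    using assms(4) by (cases "j = k") auto
  hence "(\<lambda>x. det (\<chi> i j. if j = k then axis l 1 $ i else A x $ i $ j)) differentiable (at x)"
    by (intro differentiable_det) simp
  moreover have "(\<lambda>x. det (A x)) differentiable (at x)" using assms(4) by (intro differentiable_det)
  ultimately show "(\<lambda>x. det (\<chi> i j. if j = k then axis l 1 $ i else A x $ i $ j) / det (A x))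
      differentiable (at x)"
    using assms(2,3) invertible_det_nz by (intro differentiable_divide) auto
qed

lemma positive_definite_invertible:
  fixes A :: "real^'n^'n"
  assumes "\<And>u. u \<noteq> 0 \<Longrightarrow> form A u u > 0"
  shows "invertible A"
proof -
  have "x = 0" if "A *v x = 0" for x
    using assms[of x] that by (auto simp: form_def)
  thus ?thesis using matrix_left_invertible_ker invertible_left_inverse by blast
qed

lemma matrix_mult_distribs:
  fixes A B :: "real^'n^'m" and D :: "real^'k^'n" and E :: "real^'m^'k"
  shows "(A + B) ** D = A ** D + B ** D" "(A - B) ** D = A ** D - B ** D"
    "E ** (A + B) = E ** A + E ** B" "E ** (A - B) = E ** A - E ** B"
  by (simp_all add: matrix_matrix_mult_def vec_eq_iff algebra_simps sum.distrib sum_subtractf)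

section \<open>Curvature of a Weyl structure\<close>

lemma nabla_T_const:
  "nabla_T G (\<lambda>_. u) Y x = frechet_derivative Y (at x) u + christoffel (G x) u (Y x)"
  by (simp add: nabla_T_def)

lemma curvature_const:
  "curvature G (\<lambda>_. u) (\<lambda>_. v) (\<lambda>_. w) x =
    (frechet_derivative (\<lambda>y. christoffel (G y) v w) (at x) u
      + christoffel (G x) u (christoffel (G x) v w))
    - (frechet_derivative (\<lambda>y. christoffel (G y) u w) (at x) v
      + christoffel (G x) v (christoffel (G x) u w))"
proof -
  have "nabla_T G (\<lambda>_. v) (\<lambda>_. w) = (\<lambda>y. christoffel (G y) v w)" for v
    by (simp add: nabla_T_def fun_eq_iff)
  moreover have "lie_bracket (\<lambda>_. u) (\<lambda>_. v) = (\<lambda>_. 0)"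
    by (simp add: lie_bracket_def fun_eq_iff)
  ultimately show ?thesis
    by (simp add: curvature_def nabla_T_const christoffel_bilinear)
qed

text \<open>The connection form of \<open>L\<close> in the coordinate trivialisation; the division
  by m is the exponent 1 / m of the determinant.\<close>

definition weight_form :: "(real^'m \<Rightarrow> real^'m^'m^'m) \<Rightarrow> real^'m \<Rightarrow> real^'m \<Rightarrow> real"
  where "weight_form G x u = (\<Sum>i\<in>UNIV. christoffel (G x) u (axis i 1) $ i) / real CARD('m)"

lemma nabla_L_const:
  "nabla_L k G (\<lambda>_. u) l x = frechet_derivative l (at x) u + k * weight_form G x u * l x"
  by (simp add: nabla_L_def weight_form_def)

text \<open>The curvature of a line bundle is the exterior derivative of its connection form: the
  quadratic terms are products of numbers and cancel.\<close>

lemma faraday_weight_form: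
  assumes "\<And>w. (\<lambda>y. weight_form G y w) differentiable (at x)"
  shows "faraday G x u v = frechet_derivative (\<lambda>y. weight_form G y v) (at x) u
    - frechet_derivative (\<lambda>y. weight_form G y u) (at x) v"
proof -
  have "nabla_L 1 G (\<lambda>_. v) (\<lambda>_. 1) = (\<lambda>y. weight_form G y v)" for v
    by (simp add: nabla_L_const fun_eq_iff)
  moreover have "lie_bracket (\<lambda>_. u) (\<lambda>_. v) = (\<lambda>_. 0)"
    by (simp add: lie_bracket_def fun_eq_iff)
  moreover have "nabla_L 1 G (\<lambda>_. 0) (\<lambda>_. 1) x = 0"
    by (simp add: nabla_L_const weight_form_def christoffel_bilinear)
  ultimately show ?thesis
    by (simp add: faraday_def curvature_L_def nabla_L_const)
qed

lemma weight_form_linear: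
  "weight_form G x (u + v) = weight_form G x u + weight_form G x v"
  "weight_form G x (r *\<^sub>R u) = r * weight_form G x u"
  "weight_form G x 0 = 0"
  "weight_form G x (\<Sum>i\<in>I. h i) = (\<Sum>i\<in>I. weight_form G x (h i))"
proof -
  have "linear (weight_form G x)"
    by (rule linearI) (simp_all add: weight_form_def christoffel_bilinear sum.distrib
        add_divide_distrib sum_distrib_left)
  thus
    "weight_form G x (u + v) = weight_form G x u + weight_form G x v"
    "weight_form G x (r *\<^sub>R u) = r * weight_form G x u"
    "weight_form G x 0 = 0"
    "weight_form G x (\<Sum>i\<in>I. h i) = (\<Sum>i\<in>I. weight_form G x (h i))"
    by (simp_all add: linear_add linear_scale linear_0 linear_sum)
qed

text \<open>One coordinate domain of the ambient manifold. All later arguments are local and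
  pointwise, so a single chart suffices.\<close>

locale weyl_patch =
  fixes C :: "real^'m \<Rightarrow> real^'m^'m" and G :: "real^'m \<Rightarrow> real^'m^'m^'m" and U :: "(real^'m) set"
  assumes open_U: "open U"
    and smooth_C: "smooth_on U C" and smooth_G: "smooth_on U G"
    and symmetric_C: "x \<in> U \<Longrightarrow> transpose (C x) = C x"
    and positive_C: "x \<in> U \<Longrightarrow> u \<noteq> 0 \<Longrightarrow> form (C x) u u > 0"
    and torsion_free_G: "x \<in> U \<Longrightarrow> christoffel (G x) u v = christoffel (G x) v u"
    and metric_C: "x \<in> U \<Longrightarrow> nabla_L 2 G (\<lambda>_. w) (\<lambda>y. form (C y) u v) x
       - form (C x) (nabla_T G (\<lambda>_. w) (\<lambda>_. u) x) v
       - form (C x) u (nabla_T G (\<lambda>_. w) (\<lambda>_. v) x) = 0"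
begin

lemma differentiable_C: "x \<in> U \<Longrightarrow> C differentiable (at x)"
  and differentiable_G: "x \<in> U \<Longrightarrow> G differentiable (at x)"
  using smooth_C smooth_G smooth_on_differentiable by blast+

lemma form_sym: "x \<in> U \<Longrightarrow> form (C x) u v = form (C x) v u"
  by (rule form_commute[OF symmetric_C])

text \<open>The equation \<nabla>c = 0 solved for the derivative of the components; the last term
  stems from the factor \<open>L^2\<close>.\<close>

lemma frechet_derivative_C:
  assumes "x \<in> U"
  shows "form (frechet_derivative C (at x) w) u v =
    form (C x) (christoffel (G x) w u) v + form (C x) u (christoffel (G x) w v)
    - 2 * weight_form G x w * form (C x) u v"
  using metric_C[OF assms, of w u v] differentiable_C[OF assms]
  by (simp add: nabla_T_const nabla_L_const frechet_derivative_form form_bilinear)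

lemma differentiable_weight_form:
  "x \<in> U \<Longrightarrow> (\<lambda>y. weight_form G y u) differentiable (at x)"
proof -
  assume x: "x \<in> U"
  have "(\<lambda>y. christoffel (G y) u (axis i 1) $ i) differentiable (at x)" for i
    by (intro differentiable_bounded_linear[OF bounded_linear_vec_nth] differentiable_christoffel
      differentiable_G x differentiable_const)
  thus ?thesis
    unfolding weight_form_def divide_inverse by (intro differentiable_mult differentiable_sum) auto
qed

lemma nabla_T_metric:
  assumes "x \<in> U" "V differentiable (at x)" "W differentiable (at x)"
  shows "frechet_derivative (\<lambda>y. form (C y) (V y) (W y)) (at x) u
    = form (C x) (nabla_T G (\<lambda>_. u) V x) (W x) + form (C x) (V x) (nabla_T G (\<lambda>_. u) W x)
      - 2 * weight_form G x u * form (C x) (V x) (W x)"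
  using assms
  by (simp add: frechet_derivative_form differentiable_C frechet_derivative_C nabla_T_const form_bilinear)

text \<open>The curvature annihilates the parallel section \<open>c\<close>, and its action on the
  factor \<open>L^2\<close> is \<open>2 F\<close>. Concretely, second derivatives of the function
  \<open>form (C y) z w\<close> commute.\<close>

lemma curvature_skew:
  assumes x: "x \<in> U"
  shows "form (C x) (curvature G (\<lambda>_. u) (\<lambda>_. v) (\<lambda>_. z) x) w
    + form (C x) z (curvature G (\<lambda>_. u) (\<lambda>_. v) (\<lambda>_. w) x)
    = 2 * faraday G x u v * form (C x) z w"
proof -
  define \<phi> where "\<phi> = (\<lambda>y. form (C y) z w)"
  have dchr: "(\<lambda>y. christoffel (G y) a b) differentiable (at x)" for a b
    by (intro differentiable_christoffel differentiable_G x differentiable_const)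
  have d\<phi>: "frechet_derivative \<phi> (at y) v = form (C y) (christoffel (G y) v z) w
      + form (C y) z (christoffel (G y) v w) - 2 * weight_form G y v * \<phi> y" if "y \<in> U" for y v
    using that nabla_T_metric[OF that, of "\<lambda>_. z" "\<lambda>_. w"]
    by (simp add: \<phi>_def nabla_T_const)
  have diff: "\<phi> differentiable (at x)"
    unfolding \<phi>_def by (intro differentiable_form differentiable_C x differentiable_const)
  \<comment> \<open>The first derivative is already expressed through Christoffel symbols, so one
    more application of the product rule suffices. The mixed products of Christoffel terms in the
    second and third line are symmetric in \<open>u\<close> and \<open>v\<close> and cancel on
    antisymmetrising.\<close>
  have dd\<phi>: "frechet_derivative (\<lambda>y. frechet_derivative \<phi> (at y) v) (at x) u =
      form (C x) (nabla_T G (\<lambda>_. u) (\<lambda>y. christoffel (G y) v z) x) w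
      + form (C x) (christoffel (G x) v z) (christoffel (G x) u w)
      + form (C x) (christoffel (G x) u z) (christoffel (G x) v w)
      + form (C x) z (nabla_T G (\<lambda>_. u) (\<lambda>y. christoffel (G y) v w) x)
      - 2 * weight_form G x u * (form (C x) (christoffel (G x) v z) w
          + form (C x) z (christoffel (G x) v w))
      - 2 * frechet_derivative (\<lambda>y. weight_form G y v) (at x) u * \<phi> x
      - 2 * weight_form G x v * frechet_derivative \<phi> (at x) u" for u v
  proof -
    define a b c where "a = (\<lambda>y. form (C y) (christoffel (G y) v z) w)"
      and "b = (\<lambda>y. form (C y) z (christoffel (G y) v w))"
      and "c = (\<lambda>y. weight_form G y v * \<phi> y)"
    have D: "a differentiable (at x)" "b differentiable (at x)" "c differentiable (at x)"
      unfolding a_def b_def c_def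
      by (intro differentiable_form differentiable_C x differentiable_const dchr differentiable_mult
          differentiable_weight_form diff)+
    have "frechet_derivative (\<lambda>y. frechet_derivative \<phi> (at y) v) (at x) u =
        frechet_derivative (\<lambda>y. a y + b y - 2 * c y) (at x) u"
      by (rule fun_cong[OF frechet_derivative_cong_open[OF open_U x]])
        (use D in \<open>auto simp: d\<phi> a_def b_def c_def\<close>)
    also have "\<dots> = frechet_derivative a (at x) u + frechet_derivative b (at x) u
        - 2 * frechet_derivative c (at x) u"
      by (rule frechet_derivative_eq)
        (use D in \<open>auto intro!: derivative_eq_intros simp: frechet_derivative_works\<close>)
    also have "frechet_derivative c (at x) u =
        frechet_derivative (\<lambda>y. weight_form G y v) (at x) u * \<phi> x
        + weight_form G x v * frechet_derivative \<phi> (at x) u"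
      unfolding c_def
      by (rule frechet_derivative_eq)
        (use differentiable_weight_form[OF x, of v] diff in
          \<open>auto intro!: derivative_eq_intros simp: frechet_derivative_works\<close>)
    also have "frechet_derivative a (at x) u =
      form (C x) (nabla_T G (\<lambda>_. u) (\<lambda>y. christoffel (G y) v z) x) w
      + form (C x) (christoffel (G x) v z) (christoffel (G x) u w)
      - 2 * weight_form G x u * form (C x) (christoffel (G x) v z) w"
      unfolding a_def by (subst nabla_T_metric[OF x dchr]) (simp_all add: nabla_T_const)
    also have "frechet_derivative b (at x) u =
      form (C x) (christoffel (G x) u z) (christoffel (G x) v w)
      + form (C x) z (nabla_T G (\<lambda>_. u) (\<lambda>y. christoffel (G y) v w) x)
      - 2 * weight_form G x u * form (C x) z (christoffel (G x) v w)"
      unfolding b_def by (subst nabla_T_metric[OF x _ dchr]) (simp_all add: nabla_T_const)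
    finally show ?thesis by (simp add: algebra_simps)
  qed
  have "smooth_on U \<phi>"
    unfolding \<phi>_def form_def
    by (rule smooth_on_bounded_linear[OF open_U _ smooth_C])
      (intro bounded_linear_compose[OF bounded_linear_inner_right]
        bounded_bilinear.bounded_linear_left[OF bounded_bilinear_matrix_vector_mult])
  hence "frechet_derivative (\<lambda>y. frechet_derivative \<phi> (at y) v) (at x) u =
      frechet_derivative (\<lambda>y. frechet_derivative \<phi> (at y) u) (at x) v"
    by (rule second_derivative_symmetric[OF open_U x])
  thus ?thesis
    unfolding dd\<phi> d\<phi>[OF x] curvature_const faraday_weight_form[OF differentiable_weight_form[OF x]]
    by (simp add: nabla_T_const form_bilinear algebra_simps \<phi>_def)
qed

text \<open>The trace of the connection form of the tangent bundle is m times
  \<open>weight_form\<close>, and the quadratic part of the curvature is a commutator, hence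
  trace-free.\<close>

lemma curvature_trace:
  assumes x: "x \<in> U"
  shows "(\<Sum>k\<in>UNIV. curvature G (\<lambda>_. u) (\<lambda>_. v) (\<lambda>_. axis k 1) x $ k)
    = real CARD('m) * faraday G x u v"
proof -
  have tr: "(\<Sum>k\<in>UNIV. (A *v (B *v axis k 1)) $ k) = trace (A ** B)" for A B :: "real^'m^'m"
    unfolding matrix_vector_mult_basis
    by (simp add: column_def trace_def matrix_vector_mult_def matrix_matrix_mult_def)
  have dchr: "(\<lambda>y. christoffel (G y) a b) differentiable (at x)" for a b
    by (intro differentiable_christoffel differentiable_G x differentiable_const)
  have "real CARD('m) * frechet_derivative (\<lambda>y. weight_form G y v) (at x) u =
      (\<Sum>k\<in>UNIV. frechet_derivative (\<lambda>y. christoffel (G y) v (axis k 1)) (at x) u $ k)" for u v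
  proof -
    have D: "((\<lambda>y. christoffel (G y) v (axis k 1) $ k) has_derivative
        (\<lambda>u. frechet_derivative (\<lambda>y. christoffel (G y) v (axis k 1)) (at x) u $ k)) (at x)" for k
      by (rule bounded_linear.has_derivative[OF bounded_linear_vec_nth])
        (use dchr frechet_derivative_works in blast)
    have "frechet_derivative (\<lambda>y. weight_form G y v) (at x) u = 
        (\<Sum>k\<in>UNIV. frechet_derivative (\<lambda>y. christoffel (G y) v (axis k 1)) (at x) u $ k) / real CARD('m)"
      unfolding weight_form_def
      by (rule frechet_derivative_eq) (auto intro!: derivative_eq_intros D)
    thus ?thesis by simp
  qed
  moreover have "(\<Sum>k\<in>UNIV. christoffel (G x) u (christoffel (G x) v (axis k 1)) $ k) =
      (\<Sum>k\<in>UNIV. christoffel (G x) v (christoffel (G x) u (axis k 1)) $ k)"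
    unfolding christoffel_conv_matrix tr by (rule trace_mul_sym)
  ultimately show ?thesis
    unfolding curvature_const faraday_weight_form[OF differentiable_weight_form[OF x]]
    by (simp add: algebra_simps sum.distrib sum_subtractf)
qed

lemma bianchi:
  assumes x: "x \<in> U"
  shows "curvature G (\<lambda>_. u) (\<lambda>_. v) (\<lambda>_. w) x + curvature G (\<lambda>_. v) (\<lambda>_. w) (\<lambda>_. u) x
    + curvature G (\<lambda>_. w) (\<lambda>_. u) (\<lambda>_. v) x = 0"
proof -
  have "frechet_derivative (\<lambda>y. christoffel (G y) a b) (at x) =
      frechet_derivative (\<lambda>y. christoffel (G y) b a) (at x)" for a b
    by (rule frechet_derivative_cong_open[OF open_U x torsion_free_G])
      (auto intro!: differentiable_christoffel differentiable_G x)
  note 1 = this[of u v] this[of v w] this[of w u] torsion_free_G[OF x, of u v]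
    torsion_free_G[OF x, of v w] torsion_free_G[OF x, of w u]
  show ?thesis
    unfolding curvature_const 1 by (simp add: algebra_simps)
qed

lemma curvature_antisym:
  "curvature G (\<lambda>_. u) (\<lambda>_. v) (\<lambda>_. w) x = - curvature G (\<lambda>_. v) (\<lambda>_. u) (\<lambda>_. w) x"
  unfolding curvature_const by simp

text \<open>Tracing the Bianchi identity leaves two Ricci terms and the trace of R(u, v), which is m
  F(u, v).\<close>

lemma ricci_antisym:
  assumes x: "x \<in> U"
  shows "ricci G x u v - ricci G x v u = - real CARD('m) * faraday G x u v"
proof -
  have "curvature G (\<lambda>_. axis k 1) (\<lambda>_. u) (\<lambda>_. v) x - curvature G (\<lambda>_. axis k 1) (\<lambda>_. v) (\<lambda>_. u) x
      = - curvature G (\<lambda>_. u) (\<lambda>_. v) (\<lambda>_. axis k 1) x" for k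
  proof -
    have "curvature G (\<lambda>_. axis k 1) (\<lambda>_. u) (\<lambda>_. v) x - curvature G (\<lambda>_. axis k 1) (\<lambda>_. v) (\<lambda>_. u) x
      = (curvature G (\<lambda>_. u) (\<lambda>_. v) (\<lambda>_. axis k 1) x + curvature G (\<lambda>_. v) (\<lambda>_. axis k 1) (\<lambda>_. u) x
        + curvature G (\<lambda>_. axis k 1) (\<lambda>_. u) (\<lambda>_. v) x) - curvature G (\<lambda>_. u) (\<lambda>_. v) (\<lambda>_. axis k 1) x"
      using curvature_antisym[of "axis k 1" v u x] by simp
    thus ?thesis unfolding bianchi[OF x] by simp
  qed
  from arg_cong[OF this, of "\<lambda>z. z $ _"]
  have "ricci G x u v - ricci G x v u =
      (\<Sum>k\<in>UNIV. - curvature G (\<lambda>_. u) (\<lambda>_. v) (\<lambda>_. axis k 1) x $ k)"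
    unfolding ricci_def sum_subtractf[symmetric] by (intro sum.cong refl) simp
  thus ?thesis by (simp add: sum_negf curvature_trace[OF x])
qed

text \<open>\<open>ricci\<close> is a trace over the coordinate basis; linearity in the traced slot
  permits evaluation in a basis adapted to the submanifold.\<close>

lemma linear_curvature:
  assumes x: "x \<in> U"
  shows "linear (\<lambda>z. curvature G (\<lambda>_. z) (\<lambda>_. u) (\<lambda>_. v) x)"
proof -
  have *: "frechet_derivative (\<lambda>y. christoffel (G y) a b) (at x) h =
      christoffel (frechet_derivative G (at x) h) a b" for a b h
    using frechet_derivative_christoffel[OF differentiable_G[OF x], of "\<lambda>_. a" "\<lambda>_. b" h]
    by (simp add: christoffel_bilinear)
  have l: "linear (frechet_derivative G (at x))"
    by (rule linear_frechet_derivative_at[OF differentiable_G[OF x]])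
  have "christoffel (g + h) a b = christoffel g a b + christoffel h a b"
    "christoffel (r *\<^sub>R g) a b = r *\<^sub>R christoffel g a b" for g h :: "real^'m^'m^'m" and a b r
    by (simp_all add: christoffel_def vec_eq_iff algebra_simps sum.distrib sum_distrib_left)
  thus ?thesis
    unfolding curvature_const * by (intro linearI)
      (simp_all add: linear_add[OF l] linear_scale[OF l] christoffel_bilinear algebra_simps)
qed

text \<open>Symmetrising Ric adds (m / 2) F, and the Faraday term of h, multiplied by m - 2, removes
  (m / 2) F - F; one F remains.\<close>

lemma schouten_weyl_orthogonal:
  assumes x: "x \<in> U" and "form (C x) u v = 0" and m: "CARD('m) > 2"
  shows "(real CARD('m) - 2) * schouten_weyl C G x u v = ricci G x u v + faraday G x u v"
proof -
  have "(real CARD('m) - 2) * schouten_weyl C G x u v =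
      (ricci G x u v + ricci G x v u) / 2 - (real CARD('m) - 2) / 2 * faraday G x u v"
    using m assms(2) by (simp add: schouten_weyl_def ricci_sym_tracefree_def field_simps)
  thus ?thesis using ricci_antisym[OF x, of u v] by (simp add: field_simps)
qed

lemma faraday_antisym:
  "x \<in> U \<Longrightarrow> faraday G x v u = - faraday G x u v"
  by (simp add: faraday_weight_form differentiable_weight_form)

text \<open>Together with the next lemma this serves the points where the normal section vanishes
  and spans no normal line.\<close>

lemma ricci_zero_right: "ricci G x u 0 = 0"
  by (simp add: ricci_def curvature_const christoffel_bilinear)

lemma faraday_zero_right: "x \<in> U \<Longrightarrow> faraday G x u 0 = 0"
  by (simp add: faraday_weight_form differentiable_weight_form weight_form_linear
      linear_0 linear_frechet_derivative_at)

end

section \<open>Immersions and their second derivatives\<close>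

locale immersed_patch = weyl_patch C G U
  for C :: "real^'m \<Rightarrow> real^'m^'m" and G :: "real^'m \<Rightarrow> real^'m^'m^'m" and U +
  fixes f :: "real^'n \<Rightarrow> real^'m" and S :: "(real^'n) set"
  assumes open_S: "open S" and smooth_f: "smooth_on S f"
    and f_in: "p \<in> S \<Longrightarrow> f p \<in> U"
    and inj_df: "p \<in> S \<Longrightarrow> inj (df f p)"
begin

definition frame :: "'n \<Rightarrow> real^'n \<Rightarrow> real^'m"
  where "frame a p = df f p (axis a 1)"

abbreviation nab :: "(real^'n \<Rightarrow> real^'m) \<Rightarrow> real^'n \<Rightarrow> real^'n \<Rightarrow> real^'m"
  where "nab V p h \<equiv> nabla_along G f (\<lambda>_. h) V p"

text \<open>The full ambient derivative of one frame field along another: its normal part is the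
  fundamental form B, its tangential part gives the induced connection on N.\<close>

definition hess :: "'n \<Rightarrow> 'n \<Rightarrow> real^'n \<Rightarrow> real^'m"
  where "hess a b p = nab (frame b) p (axis a 1)"

definition hess_form :: "real^'n \<Rightarrow> real^'n \<Rightarrow> real^'n \<Rightarrow> real^'m"
  where "hess_form p u w = (\<Sum>a\<in>UNIV. \<Sum>b\<in>UNIV. (u $ a * w $ b) *\<^sub>R hess a b p)"

abbreviation amb :: "real^'n \<Rightarrow> real^'m \<Rightarrow> real^'m \<Rightarrow> real"
  where "amb p \<equiv> form (C (f p))"

abbreviation gram :: "real^'n \<Rightarrow> real^'n^'n"
  where "gram \<equiv> induced_conformal C f"

abbreviation gram_inv :: "real^'n \<Rightarrow> real^'n^'n"
  where "gram_inv p \<equiv> matrix_inv (gram p)"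

abbreviation tang :: "real^'n \<Rightarrow> real^'m \<Rightarrow> real^'n"
  where "tang \<equiv> tangential_part C f"

abbreviation weight :: "real^'n \<Rightarrow> real^'n \<Rightarrow> real"
  where "weight p h \<equiv> weight_form G (f p) (df f p h)"

text \<open>The mean curvature vector before projection to the normal bundle. The tangential part is
  kept so that no projection has to be differentiated.\<close>

definition mean_hess :: "real^'n \<Rightarrow> real^'m"
  where "mean_hess p = (1 / real CARD('n)) *\<^sub>R
    (\<Sum>a\<in>UNIV. \<Sum>b\<in>UNIV. gram_inv p $ a $ b *\<^sub>R hess a b p)"

lemma differentiable_f: "p \<in> S \<Longrightarrow> f differentiable (at p)"
  using smooth_f smooth_on_differentiable by blast

lemma linear_df: "p \<in> S \<Longrightarrow> linear (df f p)"
  using linear_frechet_derivative_at[OF differentiable_f] by (simp add: df_def[abs_def])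

lemma df_frame: "p \<in> S \<Longrightarrow> df f p w = (\<Sum>a\<in>UNIV. w $ a *\<^sub>R frame a p)"
proof -
  assume p: "p \<in> S"
  have "df f p w = df f p (\<Sum>a\<in>UNIV. w $ a *\<^sub>R axis a 1)"
    by (subst vec_axis_sum[of w]) (rule refl)
  thus ?thesis by (simp add: linear_sum[OF linear_df[OF p]] linear_scale[OF linear_df[OF p]] frame_def)
qed

lemma smooth_frame: "smooth_on S (frame a)"
  using smooth_on_frechet_derivative[OF smooth_f] by (simp add: frame_def[abs_def] df_def)

lemma differentiable_frame: "p \<in> S \<Longrightarrow> frame a differentiable (at p)"
  using smooth_frame smooth_on_differentiable by blast

lemma differentiable_frechet_frame:
  "p \<in> S \<Longrightarrow> (\<lambda>p. frechet_derivative (frame b) (at p) h) differentiable (at p)"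
  using smooth_on_frechet_derivative[OF smooth_frame] smooth_on_differentiable by blast

lemma differentiable_Cf: "p \<in> S \<Longrightarrow> (\<lambda>p. C (f p)) differentiable (at p)"
  using differentiable_chain_at[OF differentiable_f differentiable_C[OF f_in]] by (simp add: o_def)

lemma differentiable_Gf: "p \<in> S \<Longrightarrow> (\<lambda>p. G (f p)) differentiable (at p)"
  using differentiable_chain_at[OF differentiable_f differentiable_G[OF f_in]] by (simp add: o_def)

lemma frechet_derivative_Cf:
  "p \<in> S \<Longrightarrow> frechet_derivative (\<lambda>p. C (f p)) (at p) h = frechet_derivative C (at (f p)) (df f p h)"
  using frechet_derivative_compose[OF differentiable_f differentiable_C[OF f_in]]
  by (simp add: o_def df_def fun_eq_iff)

lemma frechet_derivative_Gf:
  "p \<in> S \<Longrightarrow> frechet_derivative (\<lambda>p. G (f p)) (at p) h = frechet_derivative G (at (f p)) (df f p h)"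
  using frechet_derivative_compose[OF differentiable_f differentiable_G[OF f_in]]
  by (simp add: o_def df_def fun_eq_iff)

lemma amb_sym: "p \<in> S \<Longrightarrow> amb p u v = amb p v u"
  by (rule form_sym[OF f_in])

lemma nabla_along_eq: "nabla_along G f X V p = nab V p (X p)"
  by (simp add: nabla_along_def)

text \<open>The pullback of \<nabla>c = 0 to sections along \<open>f\<close>; the last term is again
  due to the weight of \<open>c\<close>.\<close>

lemma nab_metric:
  assumes "p \<in> S" "V differentiable (at p)" "W differentiable (at p)"
  shows "frechet_derivative (\<lambda>p. amb p (V p) (W p)) (at p) h =
    amb p (nab V p h) (W p) + amb p (V p) (nab W p h) - 2 * weight p h * amb p (V p) (W p)"
  using assms
  by (simp add: frechet_derivative_form differentiable_Cf frechet_derivative_Cf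
      frechet_derivative_C[OF f_in] nabla_along_def form_bilinear)

lemma nab_cong:
  assumes "p \<in> S" "\<And>p. p \<in> S \<Longrightarrow> V p = W p" "W differentiable (at p)"
  shows "nab V p h = nab W p h"
  using frechet_derivative_cong_open[OF open_S assms] assms(1,2) by (simp add: nabla_along_def)

lemma nab_linear_direction:
  assumes "p \<in> S" "V differentiable (at p)"
  shows "nab V p h = (\<Sum>a\<in>UNIV. h $ a *\<^sub>R nab V p (axis a 1))"
proof -
  have l: "linear (\<lambda>h. nab V p h)"
    unfolding nabla_along_def
    using linear_frechet_derivative_at[OF assms(2)] linear_df[OF assms(1)]
    by (intro linearI) (simp_all add: linear_add linear_scale christoffel_bilinear algebra_simps)
  from arg_cong[OF vec_axis_sum[of h], of "nab V p"] have "nab V p h = nab V p (\<Sum>a\<in>UNIV. h $ a *\<^sub>R axis a 1)" .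
  thus ?thesis by (simp only: linear_sum[OF l] linear_scale[OF l])
qed

lemma nab_diff:
  assumes "V differentiable (at p)" "W differentiable (at p)"
  shows "nab (\<lambda>p. V p - W p) p h = nab V p h - nab W p h"
proof -
  have "frechet_derivative (\<lambda>p. V p - W p) (at p) h =
      frechet_derivative V (at p) h - frechet_derivative W (at p) h"
    by (rule frechet_derivative_eq)
      (use assms in \<open>auto intro!: derivative_eq_intros simp: frechet_derivative_works\<close>)
  thus ?thesis by (simp add: nabla_along_def christoffel_bilinear)
qed

lemma nab_scale:
  fixes r :: "real^'n \<Rightarrow> real"
  assumes "r differentiable (at p)" "V differentiable (at p)"
  shows "nab (\<lambda>p. r p *\<^sub>R V p) p h = frechet_derivative r (at p) h *\<^sub>R V p + r p *\<^sub>R nab V p h"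
proof -
  have "frechet_derivative (\<lambda>p. r p *\<^sub>R V p) (at p) h =
      r p *\<^sub>R frechet_derivative V (at p) h + frechet_derivative r (at p) h *\<^sub>R V p"
    by (rule frechet_derivative_eq, rule has_derivative_scaleR)
      (use assms in \<open>auto simp: frechet_derivative_works\<close>)
  thus ?thesis by (simp add: nabla_along_def christoffel_bilinear algebra_simps)
qed

lemma nab_sum:
  assumes "\<And>i. i \<in> I \<Longrightarrow> V i differentiable (at p)"
  shows "nab (\<lambda>p. \<Sum>i\<in>I. V i p) p h = (\<Sum>i\<in>I. nab (V i) p h)"
proof -
  have "frechet_derivative (\<lambda>p. \<Sum>i\<in>I. V i p) (at p) h =
      (\<Sum>i\<in>I. frechet_derivative (V i) (at p) h)"
    by (rule frechet_derivative_eq, rule has_derivative_sum)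
      (use assms in \<open>auto simp: frechet_derivative_works\<close>)
  thus ?thesis by (simp add: nabla_along_def christoffel_bilinear sum.distrib)
qed

lemma differentiable_nab:
  assumes "p \<in> S" "\<And>h. (\<lambda>p. frechet_derivative V (at p) h) differentiable (at p)"
    "V differentiable (at p)"
  shows "(\<lambda>p. nab V p (axis a 1)) differentiable (at p)"
  unfolding nabla_along_def frame_def[symmetric]
  using assms by (intro differentiable_add differentiable_christoffel differentiable_Gf
      differentiable_frame)

lemma differentiable_hess: "p \<in> S \<Longrightarrow> hess a b differentiable (at p)"
  unfolding hess_def[abs_def]
  by (intro differentiable_nab differentiable_frechet_frame differentiable_frame)

text \<open>The second derivatives of \<open>f\<close> commute, and the Christoffel term is
  symmetric since the connection is torsion-free.\<close>

lemma hess_sym: "p \<in> S \<Longrightarrow> hess a b p = hess b a p"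
  unfolding hess_def nabla_along_def frame_def[symmetric]
  using second_derivative_symmetric[OF open_S _ smooth_f, of p "axis a 1" "axis b 1"]
    torsion_free_G[OF f_in, of p "frame a p" "frame b p"]
  by (simp add: frame_def[abs_def] df_def)

section \<open>The induced metric, its inverse and the orthogonal projections\<close>

lemma gram_component: "gram p $ a $ b = amb p (frame a p) (frame b p)"
  by (simp add: induced_conformal_def frame_def)

lemma transpose_gram: "p \<in> S \<Longrightarrow> transpose (gram p) = gram p"
  by (simp add: vec_eq_iff transpose_def gram_component amb_sym)

lemma form_gram_sum: "form (gram p) u w = (\<Sum>a\<in>UNIV. \<Sum>b\<in>UNIV. u $ a * w $ b * gram p $ a $ b)"
  by (simp add: form_def inner_vec_def matrix_vector_mult_def sum_distrib_left mult_ac)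

lemma form_gram: "p \<in> S \<Longrightarrow> form (gram p) u w = amb p (df f p u) (df f p w)"
  unfolding form_gram_sum
  by (simp add: df_frame form_bilinear gram_component sum_distrib_left mult_ac)
    (rule sum.swap)

lemma positive_gram: "p \<in> S \<Longrightarrow> u \<noteq> 0 \<Longrightarrow> form (gram p) u u > 0"
  unfolding form_gram
  using positive_C[OF f_in, of p "df f p u"] inj_df[of p] linear_df[of p]
  by (metis linear_injective_0)

lemma invertible_gram: "p \<in> S \<Longrightarrow> invertible (gram p)"
  by (rule positive_definite_invertible[OF positive_gram])

lemma gram_inv_gram:
  "p \<in> S \<Longrightarrow> (\<Sum>b\<in>UNIV. gram_inv p $ a $ b * gram p $ b $ d) = (if a = d then 1 else 0)"
  using arg_cong[OF matrix_inv_times_self[OF invertible_gram], of p "\<lambda>A. A $ a $ d"]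
  by (simp add: mat_def matrix_matrix_mult_def)

lemma differentiable_gram: "p \<in> S \<Longrightarrow> (\<lambda>p. gram p $ a $ b) differentiable (at p)"
  unfolding gram_component
  by (intro differentiable_form differentiable_Cf differentiable_frame)

lemma differentiable_gram_inv: "p \<in> S \<Longrightarrow> (\<lambda>p. gram_inv p $ a $ b) differentiable (at p)"
  by (rule differentiable_matrix_inv[OF open_S _ invertible_gram differentiable_gram])

lemma tang_component:
  "tang p v $ a = (\<Sum>b\<in>UNIV. gram_inv p $ a $ b * amb p v (frame b p))"
  by (simp add: tangential_part_def matrix_vector_mult_def frame_def)

lemma linear_tang: "linear (tang p)"
  by (rule linearI) (simp_all add: vec_eq_iff tang_component form_bilinear algebra_simps
      sum.distrib sum_distrib_left)

text \<open>The characterisation of \<open>tang\<close> as orthogonal projection: multiplication by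
  the Gram matrix undoes the inverse in its definition.\<close>

lemma form_gram_tang:
  assumes p: "p \<in> S" shows "form (gram p) (tang p v) w = amb p v (df f p w)"
proof -
  have "gram p *v tang p v = (\<chi> b. amb p v (frame b p))"
    unfolding tangential_part_def matrix_vector_mul_assoc times_matrix_inv_self[OF invertible_gram[OF p]]
    by (simp add: frame_def)
  thus ?thesis
    by (subst form_commute[OF transpose_gram[OF p]])
      (simp add: form_def[of "gram p"] inner_vec_def df_frame[OF p] form_bilinear)
qed

lemma amb_tang: "p \<in> S \<Longrightarrow> amb p (df f p (tang p v)) (df f p w) = amb p v (df f p w)"
  using form_gram_tang form_gram by metis

lemma normal_normal_part: "p \<in> S \<Longrightarrow> is_normal C f p (normal_part C f p v)"
  by (simp add: is_normal_def normal_part_def form_bilinear amb_tang)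

lemma amb_normal_part:
  "p \<in> S \<Longrightarrow> is_normal C f p \<eta> \<Longrightarrow> amb p (normal_part C f p v) \<eta> = amb p v \<eta>"
  by (simp add: is_normal_def normal_part_def form_bilinear amb_sym[of p "df f p _" \<eta>])

lemma normal_part_self_adjoint:
  "p \<in> S \<Longrightarrow> amb p (normal_part C f p u) v = amb p u (normal_part C f p v)"
  by (metis amb_sym amb_normal_part normal_normal_part)

lemma differentiable_tang_component:
  assumes "p \<in> S" "V differentiable (at p)"
  shows "(\<lambda>p. tang p (V p) $ a) differentiable (at p)"
proof -
  have "(\<lambda>p. gram_inv p $ a $ b * amb p (V p) (frame b p)) differentiable (at p)" for b
    using assms by (intro differentiable_mult differentiable_gram_inv differentiable_form
        differentiable_Cf differentiable_frame)
  thus ?thesis unfolding tang_component by (intro differentiable_sum) auto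
qed

lemma differentiable_tang:
  "p \<in> S \<Longrightarrow> V differentiable (at p) \<Longrightarrow> (\<lambda>p. tang p (V p)) differentiable (at p)"
  by (rule differentiable_vec[OF differentiable_tang_component])

lemma differentiable_df:
  assumes "p \<in> S" "Y differentiable (at p)"
  shows "(\<lambda>p. df f p (Y p)) differentiable (at p)"
proof (rule differentiable_cong_open[OF open_S assms(1) df_frame])
  have "(\<lambda>p. Y p $ a *\<^sub>R frame a p) differentiable (at p)" for a
    using assms by (intro differentiable_scaleR differentiable_frame
        differentiable_bounded_linear[OF bounded_linear_vec_nth])
  thus "(\<lambda>p. \<Sum>a\<in>UNIV. Y p $ a *\<^sub>R frame a p) differentiable (at p)"
    by (intro differentiable_sum) auto
qed

lemma differentiable_normal_part:
  "p \<in> S \<Longrightarrow> V differentiable (at p) \<Longrightarrow> (\<lambda>p. normal_part C f p (V p)) differentiable (at p)"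
  unfolding normal_part_def by (intro differentiable_diff differentiable_df differentiable_tang)

lemma differentiable_mean_hess: "p \<in> S \<Longrightarrow> mean_hess differentiable (at p)"
proof -
  assume p: "p \<in> S"
  have "(\<lambda>p. gram_inv p $ a $ b *\<^sub>R hess a b p) differentiable (at p)" for a b
    using p by (intro differentiable_scaleR differentiable_gram_inv differentiable_hess)
  thus ?thesis
    unfolding mean_hess_def[abs_def] by (intro differentiable_scaleR differentiable_sum) auto
qed

section \<open>The bilinear extension of the second derivatives\<close>

lemma hess_form_bilinear:
  "hess_form p (u + u') w = hess_form p u w + hess_form p u' w"
  "hess_form p (u - u') w = hess_form p u w - hess_form p u' w"
  "hess_form p (r *\<^sub>R u) w = r *\<^sub>R hess_form p u w"
  "hess_form p 0 w = 0"
  "hess_form p (\<Sum>i\<in>I. h i) w = (\<Sum>i\<in>I. hess_form p (h i) w)"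
  "hess_form p w (u + u') = hess_form p w u + hess_form p w u'"
  "hess_form p w (u - u') = hess_form p w u - hess_form p w u'"
  "hess_form p w (r *\<^sub>R u) = r *\<^sub>R hess_form p w u"
  "hess_form p w 0 = 0"
  "hess_form p w (\<Sum>i\<in>I. h i) = (\<Sum>i\<in>I. hess_form p w (h i))"
proof -
  have "linear (\<lambda>u. hess_form p u w)" "linear (hess_form p w)"
    by (auto intro!: linearI simp: hess_form_def algebra_simps sum.distrib scaleR_sum_right)
  note l1 = this(1) and l2 = this(2)
  show
    "hess_form p (u + u') w = hess_form p u w + hess_form p u' w"
    "hess_form p (u - u') w = hess_form p u w - hess_form p u' w"
    "hess_form p (r *\<^sub>R u) w = r *\<^sub>R hess_form p u w"
    "hess_form p 0 w = 0"
    "hess_form p (\<Sum>i\<in>I. h i) w = (\<Sum>i\<in>I. hess_form p (h i) w)"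
    using linear_add[OF l1] linear_diff[OF l1] linear_scale[OF l1] linear_0[OF l1] linear_sum[OF l1]
    by auto
  show
    "hess_form p w (u + u') = hess_form p w u + hess_form p w u'"
    "hess_form p w (u - u') = hess_form p w u - hess_form p w u'"
    "hess_form p w (r *\<^sub>R u) = r *\<^sub>R hess_form p w u"
    "hess_form p w 0 = 0"
    "hess_form p w (\<Sum>i\<in>I. h i) = (\<Sum>i\<in>I. hess_form p w (h i))"
    using linear_add[OF l2] linear_diff[OF l2] linear_scale[OF l2] linear_0[OF l2] linear_sum[OF l2]
    by auto
qed

lemma hess_form_axis_left: "hess_form p (axis a 1) w = (\<Sum>b\<in>UNIV. w $ b *\<^sub>R hess a b p)"
proof -
  have "hess_form p (axis a 1) w =
      (\<Sum>c\<in>UNIV. if c = a then \<Sum>b\<in>UNIV. w $ b *\<^sub>R hess c b p else 0)"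
    unfolding hess_form_def by (intro sum.cong refl) (simp add: axis_def)
  thus ?thesis by simp
qed

lemma hess_form_axis_right: "hess_form p u (axis b 1) = (\<Sum>a\<in>UNIV. u $ a *\<^sub>R hess a b p)"
proof -
  have "hess_form p u (axis b 1) =
      (\<Sum>a\<in>UNIV. \<Sum>c\<in>UNIV. if c = b then u $ a *\<^sub>R hess a c p else 0)"
    unfolding hess_form_def by (intro sum.cong refl) (simp add: axis_def)
  thus ?thesis by simp
qed

lemma hess_form_axis: "hess_form p (axis a 1) (axis b 1) = hess a b p"
proof -
  have "(\<Sum>c\<in>UNIV. (axis b 1 :: real^'n) $ c *\<^sub>R hess a c p) = (\<Sum>c\<in>UNIV. if c = b then hess a c p else 0)"
    by (intro sum.cong refl) (simp add: axis_def)
  thus ?thesis by (simp add: hess_form_axis_left)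
qed

lemma nab_frame: "p \<in> S \<Longrightarrow> nab (frame b) p h = hess_form p h (axis b 1)"
  by (simp add: nab_linear_direction[OF _ differentiable_frame, of p h b] hess_form_axis_right hess_def)

text \<open>Expanding \<open>Y\<close> in the frame separates a tangential term, the only one with a
  derivative of \<open>Y\<close>, from a tensorial one. This is the source of all later
  tensoriality.\<close>

lemma nab_df:
  assumes p: "p \<in> S" and Y: "Y differentiable (at p)"
  shows "nab (\<lambda>p. df f p (Y p)) p h = df f p (frechet_derivative Y (at p) h) + hess_form p h (Y p)"
proof -
  have Ya: "(\<lambda>p. Y p $ a) differentiable (at p)" for a
    by (rule differentiable_bounded_linear[OF bounded_linear_vec_nth Y])
  have d: "(\<lambda>p. Y p $ a *\<^sub>R frame a p) differentiable (at p)" for a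
    using p Ya by (intro differentiable_scaleR differentiable_frame)
  have "nab (\<lambda>p. df f p (Y p)) p h = nab (\<lambda>p. \<Sum>a\<in>UNIV. Y p $ a *\<^sub>R frame a p) p h"
    by (rule nab_cong[OF p df_frame]) (use d in \<open>auto intro!: differentiable_sum\<close>)
  also have "\<dots> = (\<Sum>a\<in>UNIV. frechet_derivative (\<lambda>p. Y p $ a) (at p) h *\<^sub>R frame a p
      + Y p $ a *\<^sub>R nab (frame a) p h)"
    by (subst nab_sum[OF d]) (simp add: nab_scale[OF Ya differentiable_frame[OF p]])
  also have "\<dots> = df f p (frechet_derivative Y (at p) h) + (\<Sum>a\<in>UNIV. Y p $ a *\<^sub>R nab (frame a) p h)"
    by (simp add: sum.distrib df_frame[OF p]
        frechet_derivative_bounded_linear[OF bounded_linear_vec_nth Y])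
  also have "(\<Sum>a\<in>UNIV. Y p $ a *\<^sub>R nab (frame a) p h) = hess_form p h (\<Sum>a\<in>UNIV. Y p $ a *\<^sub>R axis a 1)"
    by (simp add: nab_frame[OF p] hess_form_bilinear)
  also have "(\<Sum>a\<in>UNIV. Y p $ a *\<^sub>R axis a 1) = Y p"
    by (rule vec_axis_sum[symmetric])
  finally show ?thesis .
qed

section \<open>The Codazzi equation and its trace\<close>

text \<open>The Christoffel symbols of the induced connection in the coordinate frame of N.\<close>

definition christoffel_N :: "'n \<Rightarrow> 'n \<Rightarrow> real^'n \<Rightarrow> real^'n"
  where "christoffel_N a b p = tang p (hess a b p)"

lemma form_gram_christoffel_N:
  "p \<in> S \<Longrightarrow> form (gram p) (christoffel_N a b p) (axis d 1) = amb p (hess a b p) (frame d p)"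
  by (simp add: christoffel_N_def form_gram_tang frame_def)

lemma form_gram_axis_right: "form (gram p) u (axis b 1) = (\<Sum>d\<in>UNIV. u $ d * gram p $ d $ b)"
  by (simp add: form_def matrix_vector_mult_basis column_def inner_vec_def)

text \<open>The induced connection preserves the induced conformal structure: paired with a frame
  field, \<open>hess\<close> contributes only its tangential part.\<close>

lemma frechet_derivative_gram:
  assumes p: "p \<in> S"
  shows "frechet_derivative (\<lambda>p. gram p $ a $ b) (at p) (axis c 1) =
    form (gram p) (christoffel_N c a p) (axis b 1) + form (gram p) (christoffel_N c b p) (axis a 1)
    - 2 * weight p (axis c 1) * gram p $ a $ b"
  unfolding gram_component form_gram_christoffel_N[OF p]
  by (simp add: nab_metric[OF p differentiable_frame[OF p] differentiable_frame[OF p]]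
      hess_def amb_sym[OF p, of "frame a p"])

text \<open>Differentiating the product of the inverse with the Gram matrix gives B' = - B A' B. The
  weight term changes sign because the inverse has weight -2.\<close>

lemma frechet_derivative_gram_inv:
  assumes p: "p \<in> S"
  shows "frechet_derivative (\<lambda>p. gram_inv p $ a $ b) (at p) (axis c 1) =
    2 * weight p (axis c 1) * gram_inv p $ a $ b
    - (\<Sum>d\<in>UNIV. gram_inv p $ a $ d * christoffel_N c d p $ b)
    - (\<Sum>d\<in>UNIV. christoffel_N c d p $ a * gram_inv p $ d $ b)"
proof -
  define A where "A = gram p"
  define B where "B = gram_inv p"
  define A' :: "real^'n^'n" where "A' = (\<chi> a b. frechet_derivative (\<lambda>p. gram p $ a $ b) (at p) (axis c 1))"
  define B' :: "real^'n^'n" where "B' = (\<chi> a b. frechet_derivative (\<lambda>p. gram_inv p $ a $ b) (at p) (axis c 1))"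
  define N :: "real^'n^'n" where "N = (\<chi> a d. christoffel_N c a p $ d)"
  have AB: "A ** B = mat 1" "B ** A = mat 1"
    unfolding A_def B_def using matrix_inv_times_self[OF invertible_gram[OF p]]
      times_matrix_inv_self[OF invertible_gram[OF p]] by auto
  have "(\<Sum>b\<in>UNIV. B' $ a $ b * A $ b $ d) + (\<Sum>b\<in>UNIV. B $ a $ b * A' $ b $ d) = 0" for a d
  proof -
    have D: "((\<lambda>p. \<Sum>b\<in>UNIV. gram_inv p $ a $ b * gram p $ b $ d) has_derivative
      (\<lambda>h. \<Sum>b\<in>UNIV. gram_inv p $ a $ b * frechet_derivative (\<lambda>p. gram p $ b $ d) (at p) h
        + frechet_derivative (\<lambda>p. gram_inv p $ a $ b) (at p) h * gram p $ b $ d)) (at p)"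
      by (intro has_derivative_sum has_derivative_mult)
        (use differentiable_gram[OF p] differentiable_gram_inv[OF p] frechet_derivative_works in blast)+
    have "frechet_derivative (\<lambda>p. \<Sum>b\<in>UNIV. gram_inv p $ a $ b * gram p $ b $ d) (at p) =
        frechet_derivative (\<lambda>p. if a = d then 1 else 0 :: real) (at p)"
      by (rule frechet_derivative_cong_open[OF open_S p gram_inv_gram]) auto
    hence "frechet_derivative (\<lambda>p. \<Sum>b\<in>UNIV. gram_inv p $ a $ b * gram p $ b $ d) (at p) (axis c 1) = 0"
      by (simp only: frechet_derivative_const)
    thus ?thesis
      unfolding frechet_derivative_eq[OF D] by (simp add: A_def B_def A'_def B'_def sum.distrib)
  qed
  hence "B' ** A + B ** A' = 0"
    by (simp add: vec_eq_iff matrix_matrix_mult_def)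
  hence "(B' ** A + B ** A') ** B = 0"
    by (simp add: matrix_matrix_mult_def vec_eq_iff)
  hence B': "B' = - (B ** A' ** B)"
    by (simp add: matrix_mult_distribs matrix_mul_assoc[symmetric] AB eq_neg_iff_add_eq_0)
  have At: "transpose A = A" unfolding A_def by (rule transpose_gram[OF p])
  \<comment> \<open>Metricity of the induced connection in matrix form; both Christoffel terms lose
    their factor \<open>A\<close> when multiplied by \<open>B\<close> on the two sides.\<close>
  have A': "A' = N ** A + A ** transpose N - (2 * weight p (axis c 1)) *\<^sub>R A"
  proof -
    have "A $ a $ d = A $ d $ a" for a d using At by (metis transpose_def vec_lambda_beta)
    thus ?thesis
      unfolding A'_def frechet_derivative_gram[OF p] form_gram_axis_right
      by (simp add: vec_eq_iff A_def N_def matrix_matrix_mult_def transpose_def mult_ac)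
  qed
  have "B ** (N ** A) ** B = B ** N"
    by (simp add: matrix_mul_assoc[symmetric] AB)
  moreover have "B ** (A ** transpose N) ** B = transpose N ** B"
    by (simp add: matrix_mul_assoc AB)
  moreover have "B ** ((2 * weight p (axis c 1)) *\<^sub>R A) ** B = (2 * weight p (axis c 1)) *\<^sub>R B"
    by (simp add: matrix_scalar_ac scalar_matrix_assoc[symmetric] AB)
  ultimately have "B' = (2 * weight p (axis c 1)) *\<^sub>R B - B ** N - transpose N ** B"
    unfolding B' A' by (simp add: matrix_mult_distribs)
  from arg_cong[OF this, of "\<lambda>M. M $ a $ b"] show ?thesis
    by (simp add: B'_def B_def N_def matrix_matrix_mult_def transpose_def)
qed

text \<open>
  For a normal \<open>\<xi>\<close>, pairing the next two vectors with \<open>\<xi>\<close> gives \<open>(\<nabla>\<^sub>cH)(\<xi>)\<close> and \<open>(\<nabla>\<^sub>cB)(e\<^sub>a, e\<^sub>b)(\<xi>)\<close>, but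
  they do not involve derivatives of \<open>\<xi>\<close>.  The three correction terms in \<open>hess_deriv\<close> are together
  symmetric in \<open>a, b, c\<close> and drop out of the Codazzi equation.
\<close>

definition mean_hess_deriv :: "'n \<Rightarrow> real^'n \<Rightarrow> real^'m"
  where "mean_hess_deriv c p = nab mean_hess p (axis c 1) - (2 * weight p (axis c 1)) *\<^sub>R mean_hess p
    - hess_form p (axis c 1) (tang p (mean_hess p))"

definition hess_deriv :: "'n \<Rightarrow> 'n \<Rightarrow> 'n \<Rightarrow> real^'n \<Rightarrow> real^'m"
  where "hess_deriv c a b p = nab (hess a b) p (axis c 1)
    - hess_form p (axis c 1) (christoffel_N a b p)
    - hess_form p (christoffel_N c a p) (axis b 1)
    - hess_form p (axis a 1) (christoffel_N c b p)"

lemma mean_hess_scaled: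
  "real CARD('n) *\<^sub>R mean_hess p = (\<Sum>a\<in>UNIV. \<Sum>b\<in>UNIV. gram_inv p $ a $ b *\<^sub>R hess a b p)"
  by (simp add: mean_hess_def)

text \<open>The inverse metric is parallel with its weight, so the trace commutes with covariant
  differentiation.\<close>

lemma trace_hess_deriv:
  assumes p: "p \<in> S"
  shows "(\<Sum>a\<in>UNIV. \<Sum>b\<in>UNIV. gram_inv p $ a $ b *\<^sub>R hess_deriv c a b p)
    = real CARD('n) *\<^sub>R mean_hess_deriv c p"
proof -
  let ?n = "real CARD('n)" and ?\<theta> = "2 * weight p (axis c 1)" and ?e = "\<lambda>a. axis a 1 :: real^'n"
  have d: "(\<lambda>p. gram_inv p $ a $ b *\<^sub>R hess a b p) differentiable (at p)" for a b
    using p by (intro differentiable_scaleR differentiable_gram_inv differentiable_hess)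
  \<comment> \<open>The factor n clears the normalisation, leaving a double sum to differentiate
    termwise.\<close>
  have "?n *\<^sub>R nab mean_hess p (?e c) = nab (\<lambda>p. ?n *\<^sub>R mean_hess p) p (?e c)"
    by (simp add: nab_scale[OF differentiable_const differentiable_mean_hess[OF p]])
  also have "\<dots> = (\<Sum>a\<in>UNIV. \<Sum>b\<in>UNIV. nab (\<lambda>p. gram_inv p $ a $ b *\<^sub>R hess a b p) p (?e c))"
  proof -
    have "(\<lambda>p. \<Sum>b\<in>UNIV. gram_inv p $ a $ b *\<^sub>R hess a b p) differentiable (at p)" for a
      using d by (intro differentiable_sum) auto
    thus ?thesis
      unfolding mean_hess_scaled by (simp add: nab_sum d)
  qed
  also have "\<dots> = (\<Sum>a\<in>UNIV. \<Sum>b\<in>UNIV.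
      (?\<theta> * gram_inv p $ a $ b) *\<^sub>R hess a b p
      - (\<Sum>d\<in>UNIV. (gram_inv p $ a $ d * christoffel_N c d p $ b) *\<^sub>R hess a b p)
      - (\<Sum>d\<in>UNIV. (christoffel_N c d p $ a * gram_inv p $ d $ b) *\<^sub>R hess a b p)
      + gram_inv p $ a $ b *\<^sub>R nab (hess a b) p (?e c))"
    by (simp only: nab_scale[OF differentiable_gram_inv[OF p] differentiable_hess[OF p]]
        frechet_derivative_gram_inv[OF p] scaleR_diff_left scaleR_sum_left)
  also have "\<dots> = ?\<theta> *\<^sub>R ?n *\<^sub>R mean_hess p
      - (\<Sum>a\<in>UNIV. \<Sum>b\<in>UNIV. \<Sum>d\<in>UNIV. (gram_inv p $ a $ d * christoffel_N c d p $ b) *\<^sub>R hess a b p)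
      - (\<Sum>a\<in>UNIV. \<Sum>b\<in>UNIV. \<Sum>d\<in>UNIV. (christoffel_N c d p $ a * gram_inv p $ d $ b) *\<^sub>R hess a b p)
      + (\<Sum>a\<in>UNIV. \<Sum>b\<in>UNIV. gram_inv p $ a $ b *\<^sub>R nab (hess a b) p (?e c))"
    unfolding mean_hess_scaled
    by (simp add: sum.distrib sum_subtractf scaleR_sum_right)
  \<comment> \<open>Renaming indices turns the Christoffel terms from the derivative of
    \<open>gram_inv\<close> into the last two corrections of \<open>hess_deriv\<close>.\<close>
  also have "(\<Sum>a\<in>UNIV. \<Sum>b\<in>UNIV. \<Sum>d\<in>UNIV. (gram_inv p $ a $ d * christoffel_N c d p $ b) *\<^sub>R hess a b p)
      = (\<Sum>a\<in>UNIV. \<Sum>b\<in>UNIV. gram_inv p $ a $ b *\<^sub>R hess_form p (?e a) (christoffel_N c b p))"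
    unfolding hess_form_axis_left scaleR_sum_right scaleR_scaleR
    by (intro sum.cong[OF refl] sum.swap)
  also have "(\<Sum>a\<in>UNIV. \<Sum>b\<in>UNIV. \<Sum>d\<in>UNIV. (christoffel_N c d p $ a * gram_inv p $ d $ b) *\<^sub>R hess a b p)
      = (\<Sum>a\<in>UNIV. \<Sum>b\<in>UNIV. gram_inv p $ a $ b *\<^sub>R hess_form p (christoffel_N c a p) (?e b))"
  proof -
    have "(\<Sum>a\<in>UNIV. \<Sum>b\<in>UNIV. gram_inv p $ a $ b *\<^sub>R hess_form p (christoffel_N c a p) (?e b))
      = (\<Sum>d\<in>UNIV. \<Sum>b\<in>UNIV. \<Sum>a\<in>UNIV. (christoffel_N c d p $ a * gram_inv p $ d $ b) *\<^sub>R hess a b p)"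
      unfolding hess_form_axis_right by (simp add: scaleR_sum_right mult.commute)
    also have "\<dots> = (\<Sum>d\<in>UNIV. \<Sum>a\<in>UNIV. \<Sum>b\<in>UNIV. (christoffel_N c d p $ a * gram_inv p $ d $ b) *\<^sub>R hess a b p)"
      by (intro sum.cong refl sum.swap)
    also have "\<dots> = (\<Sum>a\<in>UNIV. \<Sum>d\<in>UNIV. \<Sum>b\<in>UNIV. (christoffel_N c d p $ a * gram_inv p $ d $ b) *\<^sub>R hess a b p)"
      by (rule sum.swap)
    also have "\<dots> = (\<Sum>a\<in>UNIV. \<Sum>b\<in>UNIV. \<Sum>d\<in>UNIV. (christoffel_N c d p $ a * gram_inv p $ d $ b) *\<^sub>R hess a b p)"
      by (intro sum.cong refl sum.swap)
    finally show ?thesis ..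
  qed
  finally have 1: "?n *\<^sub>R nab mean_hess p (?e c) = ?\<theta> *\<^sub>R ?n *\<^sub>R mean_hess p
      - (\<Sum>a\<in>UNIV. \<Sum>b\<in>UNIV. gram_inv p $ a $ b *\<^sub>R hess_form p (?e a) (christoffel_N c b p))
      - (\<Sum>a\<in>UNIV. \<Sum>b\<in>UNIV. gram_inv p $ a $ b *\<^sub>R hess_form p (christoffel_N c a p) (?e b))
      + (\<Sum>a\<in>UNIV. \<Sum>b\<in>UNIV. gram_inv p $ a $ b *\<^sub>R nab (hess a b) p (?e c))" .
  \<comment> \<open>The tangential part of the trace is the trace of the
    \<open>christoffel_N a b p\<close>, which accounts for the first correction of
    \<open>hess_deriv\<close>.\<close>
  have "?n *\<^sub>R hess_form p (?e c) (tang p (mean_hess p)) =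
      hess_form p (?e c) (tang p (?n *\<^sub>R mean_hess p))"
    by (simp add: linear_scale[OF linear_tang] hess_form_bilinear)
  also have "\<dots> = (\<Sum>a\<in>UNIV. \<Sum>b\<in>UNIV. gram_inv p $ a $ b *\<^sub>R hess_form p (?e c) (christoffel_N a b p))"
    unfolding mean_hess_scaled christoffel_N_def
    by (simp add: linear_sum[OF linear_tang] linear_scale[OF linear_tang] hess_form_bilinear)
  finally show ?thesis
    unfolding mean_hess_deriv_def hess_deriv_def
    by (simp add: scaleR_diff_right 1 sum_subtractf sum.distrib algebra_simps)
qed

text \<open>Third derivatives of \<open>f\<close> are symmetric, so antisymmetrising leaves the
  curvature of the ambient connection. The identity holds for the full vectors, without
  projection.\<close>

lemma codazzi:
  assumes p: "p \<in> S"
  shows "hess_deriv c a b p - hess_deriv a c b p =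
    curvature G (\<lambda>_. frame c p) (\<lambda>_. frame a p) (\<lambda>_. frame b p) (f p)"
proof -
  let ?e = "\<lambda>a. axis a 1 :: real^'n"
  have hess_eq: "hess a b = (\<lambda>p. frechet_derivative (frame b) (at p) (?e a)
      + christoffel (G (f p)) (frame a p) (frame b p))" for a b
    by (simp add: hess_def[abs_def] nabla_along_def frame_def[symmetric] fun_eq_iff)
  have dG: "frechet_derivative (\<lambda>y. christoffel (G y) v w) (at (f p)) u =
      christoffel (frechet_derivative G (at (f p)) u) v w" for u v w
    using frechet_derivative_christoffel[OF differentiable_G[OF f_in[OF p]], of "\<lambda>_. v" "\<lambda>_. w" u]
    by (simp add: christoffel_bilinear)
  have nab_hess: "nab (hess a b) p (?e c) =
      frechet_derivative (\<lambda>p. frechet_derivative (frame b) (at p) (?e a)) (at p) (?e c)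
      + christoffel (frechet_derivative G (at (f p)) (frame c p)) (frame a p) (frame b p)
      + christoffel (G (f p)) (frechet_derivative (frame a) (at p) (?e c)) (frame b p)
      + christoffel (G (f p)) (frame a p) (frechet_derivative (frame b) (at p) (?e c))
      + christoffel (G (f p)) (frame c p) (hess a b p)" for a c
  proof -
    have "frechet_derivative (hess a b) (at p) (?e c) =
      frechet_derivative (\<lambda>p. frechet_derivative (frame b) (at p) (?e a)) (at p) (?e c)
      + frechet_derivative (\<lambda>p. christoffel (G (f p)) (frame a p) (frame b p)) (at p) (?e c)"
      unfolding hess_eq
      by (rule frechet_derivative_eq, rule has_derivative_add)
        (use p in \<open>auto simp: frechet_derivative_works[symmetric] intro!: differentiable_frechet_frame
          differentiable_christoffel differentiable_Gf differentiable_frame\<close>)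
    thus ?thesis
      by (simp add: nabla_along_def frame_def[symmetric] frechet_derivative_christoffel
          differentiable_Gf differentiable_frame frechet_derivative_Gf p)
  qed
  have sym2: "frechet_derivative (\<lambda>p. frechet_derivative (frame b) (at p) (?e a)) (at p) (?e c) =
      frechet_derivative (\<lambda>p. frechet_derivative (frame b) (at p) (?e c)) (at p) (?e a)"
    by (rule second_derivative_symmetric[OF open_S p smooth_frame])
  have sym1: "frechet_derivative (frame a) (at p) (?e c) = frechet_derivative (frame c) (at p) (?e a)"
    using second_derivative_symmetric[OF open_S p smooth_f, of "?e a" "?e c"]
    by (simp add: frame_def[abs_def] df_def)
  \<comment> \<open>Exchanging \<open>a\<close> and \<open>c\<close> interchanges the first and
    third corrections of \<open>hess_deriv\<close> and, by this symmetry, fixes the second.\<close>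
  have N: "christoffel_N a c p = christoffel_N c a p" by (simp add: christoffel_N_def hess_sym[OF p])
  have "hess_deriv c a b p - hess_deriv a c b p = nab (hess a b) p (?e c) - nab (hess c b) p (?e a)"
    unfolding hess_deriv_def N by simp
  also have "\<dots> = curvature G (\<lambda>_. frame c p) (\<lambda>_. frame a p) (\<lambda>_. frame b p) (f p)"
    unfolding nab_hess sym1 sym2 curvature_const dG
    by (simp add: hess_eq christoffel_bilinear)
  finally show ?thesis .
qed

section \<open>Derivatives of the mean curvature and of the trace-free fundamental form\<close>

lemma tang_df: "p \<in> S \<Longrightarrow> tang p (df f p w) = w"
proof -
  assume p: "p \<in> S"
  have "form (gram p) (tang p (df f p w) - w) v = 0" for v
    by (simp add: form_bilinear form_gram[OF p] amb_tang[OF p])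
  hence "tang p (df f p w) - w = 0"
    by (rule form_nondegenerate[OF _ positive_gram[OF p]])
  thus ?thesis by simp
qed

lemma linear_normal_part: "p \<in> S \<Longrightarrow> linear (normal_part C f p)"
  unfolding normal_part_def
  by (intro linear_compose_sub linear_ident linear_compose[OF linear_tang linear_df, unfolded o_def])

lemma normal_part_df: "p \<in> S \<Longrightarrow> normal_part C f p (df f p w) = 0"
  by (simp add: normal_part_def tang_df)

text \<open>The Weingarten relation, obtained by differentiating the vanishing pairing of
  \<open>V\<close> with \<open>df f p w\<close>; the weight term carries that pairing as a factor
  and disappears.\<close>

lemma nab_normal_section:
  assumes p: "p \<in> S" and V: "V differentiable (at p)" "\<And>p. p \<in> S \<Longrightarrow> is_normal C f p (V p)"
  shows "amb p (nab V p h) (df f p w) = - amb p (V p) (hess_form p h w)"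
proof -
  have d: "(\<lambda>p. df f p w) differentiable (at p)"
    by (rule differentiable_df[OF p differentiable_const])
  have "frechet_derivative (\<lambda>p. amb p (V p) (df f p w)) (at p) = frechet_derivative (\<lambda>p. 0 :: real) (at p)"
    by (rule frechet_derivative_cong_open[OF open_S p]) (use V(2) in \<open>auto simp: is_normal_def\<close>)
  moreover have "amb p (V p) (df f p w) = 0" using V(2)[OF p] by (simp add: is_normal_def)
  ultimately have "amb p (nab V p h) (df f p w) + amb p (V p) (nab (\<lambda>p. df f p w) p h) = 0"
    using nab_metric[OF p V(1) d, of h] by simp
  thus ?thesis
    using nab_df[OF p differentiable_const, of h w] linear_0[OF linear_df[OF p]] by simp
qed

text \<open>The minus sign of the Weingarten relation cancels the one in the definition, and no
  derivative of \<open>V\<close> survives.\<close>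

lemma mean_curvature_normal_section:
  assumes p: "p \<in> S" and V: "V differentiable (at p)" "\<And>p. p \<in> S \<Longrightarrow> is_normal C f p (V p)"
  shows "mean_curvature C G f V p = amb p (V p) (mean_hess p)"
proof -
  have "amb p (nab V p (axis a 1)) (frame b p) = - amb p (V p) (hess a b p)" for a b
    using nab_normal_section[OF assms, of "axis a 1" "axis b 1"]
    by (simp add: frame_def hess_form_axis)
  thus ?thesis
    unfolding mean_curvature_def tang_component mean_hess_def
    by (simp add: form_bilinear sum_negf)
qed

text \<open>The normal projection is self-adjoint, so the covector whose index is raised is the
  pairing with the projected vector.\<close>

lemma mean_curvature_vector_eq:
  assumes p: "p \<in> S"
  shows "mean_curvature_vector C G f p = normal_part C f p (mean_hess p)"
proof -
  have "mean_curvature C G f (\<lambda>p. normal_part C f p (axis i 1)) p =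
      (C (f p) *v normal_part C f p (mean_hess p)) $ i" for i
  proof -
    have "mean_curvature C G f (\<lambda>p. normal_part C f p (axis i 1)) p =
        amb p (normal_part C f p (axis i 1)) (mean_hess p)"
      by (rule mean_curvature_normal_section[OF p])
        (use p in \<open>auto intro: differentiable_normal_part normal_normal_part\<close>)
    also have "\<dots> = amb p (axis i 1) (normal_part C f p (mean_hess p))"
      by (rule normal_part_self_adjoint[OF p])
    finally show ?thesis by (simp add: form_def inner_axis')
  qed
  hence "(\<chi> i. mean_curvature C G f (\<lambda>p. normal_part C f p (axis i 1)) p) =
      C (f p) *v normal_part C f p (mean_hess p)"
    by (simp add: vec_eq_iff)
  moreover have "invertible (C (f p))"
    by (rule positive_definite_invertible[OF positive_C[OF f_in[OF p]]])
  ultimately show ?thesis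
    by (simp add: mean_curvature_vector_def matrix_vector_mul_assoc matrix_inv_times_self)
qed

text \<open>The form \<open>B0\<close> before projection; unlike \<open>B0\<close> it takes vectors,
  not sections.\<close>

definition tracefree_hess :: "real^'n \<Rightarrow> real^'n \<Rightarrow> real^'n \<Rightarrow> real^'m"
  where "tracefree_hess p u w = hess_form p u w - form (gram p) u w *\<^sub>R mean_hess p"

text \<open>The only term with a derivative of \<open>Y\<close> is tangential and is removed by the
  projection.\<close>

lemma B0_eq:
  assumes p: "p \<in> S" and Y: "Y differentiable (at p)"
  shows "B0 C G f X Y p = normal_part C f p (tracefree_hess p (X p) (Y p))"
  unfolding B0_def fundamental_form_def nabla_along_eq[of X] nab_df[OF assms]
    mean_curvature_vector_eq[OF p] tracefree_hess_def
  using linear_normal_part[OF p]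
  by (simp add: linear_add linear_diff linear_scale normal_part_df[OF p])

text \<open>The subtracted field is \<open>df\<close> of the tangential part; by
  \<open>nab_df\<close> its derivative is a tangential vector, invisible to \<open>\<eta>\<close>,
  plus a second fundamental form term.\<close>

lemma nab_normal_part:
  assumes p: "p \<in> S" and V: "V differentiable (at p)" and \<eta>: "is_normal C f p \<eta>"
  shows "amb p (nab (\<lambda>p. normal_part C f p (V p)) p h) \<eta> =
    amb p (nab V p h - hess_form p h (tang p (V p))) \<eta>"
proof -
  have "amb p (df f p w) \<eta> = 0" for w
    using \<eta> amb_sym[OF p] by (simp add: is_normal_def)
  thus ?thesis
    unfolding normal_part_def
    by (simp add: nab_diff V differentiable_df differentiable_tang p nab_df form_bilinear)
qed

lemma tracefree_hess_bilinear:
  "tracefree_hess p (u + u') w = tracefree_hess p u w + tracefree_hess p u' w"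
  "tracefree_hess p (r *\<^sub>R u) w = r *\<^sub>R tracefree_hess p u w"
  "tracefree_hess p (\<Sum>i\<in>I. h i) w = (\<Sum>i\<in>I. tracefree_hess p (h i) w)"
proof -
  have l: "linear (\<lambda>u. tracefree_hess p u w)"
    by (rule linearI) (simp_all add: tracefree_hess_def hess_form_bilinear form_bilinear algebra_simps)
  show
    "tracefree_hess p (u + u') w = tracefree_hess p u w + tracefree_hess p u' w"
    "tracefree_hess p (r *\<^sub>R u) w = r *\<^sub>R tracefree_hess p u w"
    "tracefree_hess p (\<Sum>i\<in>I. h i) w = (\<Sum>i\<in>I. tracefree_hess p (h i) w)"
    using linear_add[OF l] linear_scale[OF l] linear_sum[OF l] by auto
qed

lemma tracefree_hess_sum:
  "tracefree_hess p u w = (\<Sum>c\<in>UNIV. u $ c *\<^sub>R tracefree_hess p (axis c 1) w)"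
  by (subst vec_axis_sum[of u]) (simp only: tracefree_hess_bilinear)

lemma tracefree_hess_axis:
  "tracefree_hess p (axis c 1) (axis b 1) = hess c b p - gram p $ c $ b *\<^sub>R mean_hess p"
  by (simp add: tracefree_hess_def hess_form_axis form_def matrix_vector_mult_basis column_def inner_axis')

lemma differentiable_tracefree_hess:
  "p \<in> S \<Longrightarrow> (\<lambda>p. tracefree_hess p (axis c 1) (axis b 1)) differentiable (at p)"
  unfolding tracefree_hess_axis
  by (intro differentiable_diff differentiable_scaleR differentiable_hess differentiable_gram
      differentiable_mean_hess)

text \<open>The identity \<open>\<nabla>B0 = \<nabla>B - g \<nabla>H\<close> before projection. The
  Christoffel terms in the derivative of \<open>gram\<close> cancel those in the arguments of
  \<open>tracefree_hess\<close>, and its weight term is the one in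
  \<open>mean_hess_deriv\<close>.\<close>

lemma nab_tracefree_hess:
  assumes p: "p \<in> S"
  shows "nab (\<lambda>p. tracefree_hess p (axis c 1) (axis b 1)) p (axis a 1)
      - hess_form p (axis a 1) (tang p (tracefree_hess p (axis c 1) (axis b 1)))
      - tracefree_hess p (christoffel_N a c p) (axis b 1)
      - tracefree_hess p (axis c 1) (christoffel_N a b p)
    = hess_deriv a c b p - gram p $ c $ b *\<^sub>R mean_hess_deriv a p"
proof -
  have "nab (\<lambda>p. tracefree_hess p (axis c 1) (axis b 1)) p (axis a 1) =
      nab (hess c b) p (axis a 1) - (frechet_derivative (\<lambda>p. gram p $ c $ b) (at p) (axis a 1) *\<^sub>R mean_hess p
        + gram p $ c $ b *\<^sub>R nab mean_hess p (axis a 1))"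
    unfolding tracefree_hess_axis
    by (subst nab_diff) (use p in \<open>auto simp: nab_scale differentiable_gram differentiable_hess
        differentiable_mean_hess intro!: differentiable_scaleR\<close>)
  moreover have "form (gram p) (axis c 1) (christoffel_N a b p) = form (gram p) (christoffel_N a b p) (axis c 1)"
    by (rule form_commute[OF transpose_gram[OF p]])
  ultimately show ?thesis
    unfolding frechet_derivative_gram[OF p] hess_deriv_def mean_hess_deriv_def tracefree_hess_axis
    by (simp add: tracefree_hess_def linear_diff[OF linear_tang] linear_scale[OF linear_tang]
        hess_form_bilinear christoffel_N_def[symmetric] algebra_simps)
qed

text \<open>Tensoriality in \<open>X\<close>: the derivatives of \<open>X\<close> from the Leibniz
  rule cancel those inside \<open>B0 (nabla_N Z X) Y\<close>.\<close>

lemma amb_nabla_B0: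
  assumes p: "p \<in> S" and X: "\<And>p. p \<in> S \<Longrightarrow> X differentiable (at p)" and \<eta>: "is_normal C f p \<eta>"
  shows "amb p (nabla_B0 C G f (\<lambda>_. axis a 1) X (\<lambda>_. axis b 1) p) \<eta> =
    (\<Sum>c\<in>UNIV. X p $ c * amb p (hess_deriv a c b p - gram p $ c $ b *\<^sub>R mean_hess_deriv a p) \<eta>)"
proof -
  let ?e = "\<lambda>a. axis a 1 :: real^'n"
  define V where "V c = (\<lambda>p. tracefree_hess p (?e c) (?e b))" for c
  define W where "W = (\<lambda>p. \<Sum>c\<in>UNIV. X p $ c *\<^sub>R V c p)"
  have W: "W p = tracefree_hess p (X p) (?e b)" for p
    unfolding W_def V_def by (rule tracefree_hess_sum[symmetric])
  have dV: "V c differentiable (at p)" for c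
    unfolding V_def by (rule differentiable_tracefree_hess[OF p])
  have dX: "(\<lambda>p. X p $ c) differentiable (at p)" for c
    by (rule differentiable_bounded_linear[OF bounded_linear_vec_nth X[OF p]])
  have dXV: "(\<lambda>p. X p $ c *\<^sub>R V c p) differentiable (at p)" for c
    by (intro differentiable_scaleR dV dX)
  have dW: "W differentiable (at p)"
    unfolding W_def using dXV by (intro differentiable_sum) auto
  have \<eta>': "amb p (normal_part C f p v) \<eta> = amb p v \<eta>" for v
    by (rule amb_normal_part[OF p \<eta>])
  have 1: "amb p (nabla_perp C G f (\<lambda>_. ?e a) (B0 C G f X (\<lambda>_. ?e b)) p) \<eta> =
      amb p (nab W p (?e a) - hess_form p (?e a) (tang p (W p))) \<eta>"
  proof -
    have "nab (B0 C G f X (\<lambda>_. ?e b)) p (?e a) = nab (\<lambda>p. normal_part C f p (W p)) p (?e a)"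
      by (rule nab_cong[OF p]) (simp_all add: B0_eq W differentiable_normal_part[OF p dW, unfolded W])
    thus ?thesis
      by (simp add: nabla_perp_def \<eta>' nab_normal_part[OF p dW \<eta>])
  qed
  have nab_const: "nabla_N C G f (\<lambda>_. ?e a) (\<lambda>_. ?e b) p = christoffel_N a b p" if "p \<in> S" for p
    using nab_df[OF that differentiable_const, of "?e a" "?e b"] linear_0[OF linear_df[OF that]]
    by (simp add: nabla_N_def hess_form_axis christoffel_N_def)
  \<comment> \<open>\<open>B0_eq\<close> requires a differentiable second argument, and here that
    argument is itself a covariant derivative.\<close>
  have dN: "nabla_N C G f (\<lambda>_. ?e a) (\<lambda>_. ?e b) differentiable (at p)"
    by (rule differentiable_cong_open[OF open_S p nab_const])
      (auto simp: christoffel_N_def intro!: differentiable_tang p differentiable_hess)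
  have 2: "amb p (B0 C G f X (nabla_N C G f (\<lambda>_. ?e a) (\<lambda>_. ?e b)) p) \<eta> =
      amb p (tracefree_hess p (X p) (christoffel_N a b p)) \<eta>"
    by (simp add: B0_eq[OF p dN] \<eta>' nab_const[OF p])
  have nabX: "nabla_N C G f (\<lambda>_. ?e a) X p =
      frechet_derivative X (at p) (?e a) + (\<Sum>c\<in>UNIV. X p $ c *\<^sub>R christoffel_N a c p)"
    by (simp add: nabla_N_def nab_df[OF p X[OF p]] linear_add[OF linear_tang] tang_df[OF p]
        hess_form_axis_left linear_sum[OF linear_tang] linear_scale[OF linear_tang] christoffel_N_def)
  have 3: "amb p (B0 C G f (nabla_N C G f (\<lambda>_. ?e a) X) (\<lambda>_. ?e b) p) \<eta> =
      amb p ((\<Sum>c\<in>UNIV. frechet_derivative X (at p) (?e a) $ c *\<^sub>R V c p)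
        + (\<Sum>c\<in>UNIV. X p $ c *\<^sub>R tracefree_hess p (christoffel_N a c p) (?e b))) \<eta>"
    unfolding B0_eq[OF p differentiable_const] \<eta>' nabX tracefree_hess_bilinear V_def
    by (subst tracefree_hess_sum) simp
  have nabW: "nab W p (?e a) = (\<Sum>c\<in>UNIV. frechet_derivative X (at p) (?e a) $ c *\<^sub>R V c p
      + X p $ c *\<^sub>R nab (V c) p (?e a))"
    unfolding W_def by (subst nab_sum[OF dXV])
      (simp add: nab_scale[OF dX dV] frechet_derivative_bounded_linear[OF bounded_linear_vec_nth X[OF p]])
  have tangW: "hess_form p (?e a) (tang p (W p)) =
      (\<Sum>c\<in>UNIV. X p $ c *\<^sub>R hess_form p (?e a) (tang p (V c p)))"
    unfolding W_def by (simp add: linear_sum[OF linear_tang] linear_scale[OF linear_tang] hess_form_bilinear)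
  have "amb p (nabla_B0 C G f (\<lambda>_. ?e a) X (\<lambda>_. ?e b) p) \<eta> =
      amb p (\<Sum>c\<in>UNIV. X p $ c *\<^sub>R (nab (V c) p (?e a)
        - hess_form p (?e a) (tang p (V c p)) - tracefree_hess p (christoffel_N a c p) (?e b)
        - tracefree_hess p (?e c) (christoffel_N a b p))) \<eta>"
    unfolding nabla_B0_def form_bilinear(2) 1 2 3 nabW tangW
      tracefree_hess_sum[of p "X p" "christoffel_N a b p"]
    unfolding form_bilinear(2)[symmetric]
    by (rule arg_cong[of _ _ "\<lambda>v. amb p v \<eta>"])
      (simp add: scaleR_diff_right sum.distrib sum_subtractf)
  thus ?thesis
    unfolding V_def nab_tracefree_hess[OF p] by (simp only: form_bilinear)
qed

text \<open>Contracting \<open>g \<nabla>H\<close> with the inverse metric returns one copy of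
  \<open>\<nabla>H\<close>, which later turns the n from the trace into n - 1.\<close>

lemma amb_delta_B0:
  assumes p: "p \<in> S" and X: "\<And>p. p \<in> S \<Longrightarrow> X differentiable (at p)" and \<eta>: "is_normal C f p \<eta>"
  shows "amb p (delta_B0 C G f X p) \<eta> =
    (\<Sum>c\<in>UNIV. X p $ c * ((\<Sum>a\<in>UNIV. \<Sum>b\<in>UNIV. gram_inv p $ a $ b * amb p (hess_deriv a c b p) \<eta>)
      - amb p (mean_hess_deriv c p) \<eta>))"
proof -
  have *: "(\<Sum>a\<in>UNIV. \<Sum>b\<in>UNIV. gram_inv p $ a $ b * (gram p $ c $ b * J a)) = J c"
    for c and J :: "'n \<Rightarrow> real"
  proof -
    have "(\<Sum>b\<in>UNIV. gram_inv p $ a $ b * (gram p $ c $ b * J a)) = (if a = c then J a else 0)" for a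
    proof -
      have "gram p $ c $ b = gram p $ b $ c" for b by (simp add: gram_component amb_sym[OF p])
      hence "(\<Sum>b\<in>UNIV. gram_inv p $ a $ b * (gram p $ c $ b * J a)) =
          (\<Sum>b\<in>UNIV. gram_inv p $ a $ b * gram p $ b $ c) * J a"
        by (simp add: sum_distrib_right mult.assoc)
      thus ?thesis by (simp add: gram_inv_gram[OF p])
    qed
    thus ?thesis by simp
  qed
  have "amb p (delta_B0 C G f X p) \<eta> = (\<Sum>a\<in>UNIV. \<Sum>b\<in>UNIV. \<Sum>c\<in>UNIV. X p $ c *
      (gram_inv p $ a $ b * amb p (hess_deriv a c b p) \<eta>
        - gram_inv p $ a $ b * (gram p $ c $ b * amb p (mean_hess_deriv a p) \<eta>)))"
    unfolding delta_B0_def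
    by (simp add: form_bilinear amb_nabla_B0[OF assms] sum_distrib_left algebra_simps)
  also have "\<dots> = (\<Sum>c\<in>UNIV. \<Sum>a\<in>UNIV. \<Sum>b\<in>UNIV. X p $ c *
      (gram_inv p $ a $ b * amb p (hess_deriv a c b p) \<eta>
        - gram_inv p $ a $ b * (gram p $ c $ b * amb p (mean_hess_deriv a p) \<eta>)))"
    by (subst sum.swap[of _ _ UNIV], subst (2) sum.swap) (rule refl)
  also have "\<dots> = (\<Sum>c\<in>UNIV. X p $ c * ((\<Sum>a\<in>UNIV. \<Sum>b\<in>UNIV. gram_inv p $ a $ b * amb p (hess_deriv a c b p) \<eta>)
      - amb p (mean_hess_deriv c p) \<eta>))"
    by (simp add: sum_distrib_left[symmetric] sum_subtractf *)
  finally show ?thesis .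
qed

text \<open>The two terms with a derivative of \<open>\<xi>\<close> differ by its pairing with the
  tangential part of \<open>mean_hess\<close>; the Weingarten relation rewrites this without
  derivatives of \<open>\<xi>\<close>.\<close>

lemma nabla_mean_curvature_eq:
  assumes p: "p \<in> S" and X: "\<And>p. p \<in> S \<Longrightarrow> X differentiable (at p)"
    and \<xi>: "smooth_on S \<xi>" "\<And>p. p \<in> S \<Longrightarrow> is_normal C f p (\<xi> p)"
  shows "nabla_mean_curvature C G f X \<xi> p = (\<Sum>c\<in>UNIV. X p $ c * amb p (mean_hess_deriv c p) (\<xi> p))"
proof -
  have d\<xi>: "\<xi> differentiable (at p)" if "p \<in> S" for p
    using \<xi>(1) that by (rule smooth_on_differentiable)
  have perp: "nabla_perp C G f X \<xi> p = normal_part C f p (\<Sum>c\<in>UNIV. X p $ c *\<^sub>R nab \<xi> p (axis c 1))"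
    if "p \<in> S" for p
    unfolding nabla_perp_def nabla_along_eq[of X]
    by (subst nab_linear_direction[OF that d\<xi>[OF that]]) (rule refl)
  \<comment> \<open>The formula for \<open>mean_curvature\<close> applies to differentiable normal
    sections, so this step uses second derivatives of \<open>\<xi>\<close>.\<close>
  have d_perp: "nabla_perp C G f X \<xi> differentiable (at p)"
  proof (rule differentiable_cong_open[OF open_S p perp])
    have "(\<lambda>p. nab \<xi> p (axis c 1)) differentiable (at p)" for c
      by (intro differentiable_nab p d\<xi> smooth_on_differentiable[of S] smooth_on_frechet_derivative \<xi>(1))
    hence "(\<lambda>p. X p $ c *\<^sub>R nab \<xi> p (axis c 1)) differentiable (at p)" for c
      by (intro differentiable_scaleR differentiable_bounded_linear[OF bounded_linear_vec_nth X[OF p]])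
    thus "(\<lambda>p. normal_part C f p (\<Sum>c\<in>UNIV. X p $ c *\<^sub>R nab \<xi> p (axis c 1))) differentiable (at p)"
      by (intro differentiable_normal_part[OF p] differentiable_sum) auto
  qed
  have 1: "mean_curvature C G f (nabla_perp C G f X \<xi>) p =
      amb p (nab \<xi> p (X p)) (normal_part C f p (mean_hess p))"
    by (subst mean_curvature_normal_section[OF p d_perp])
      (simp_all add: nabla_perp_def normal_normal_part normal_part_self_adjoint[OF p] nabla_along_eq[of X])
  have "frechet_derivative (mean_curvature C G f \<xi>) (at p) =
      frechet_derivative (\<lambda>p. amb p (\<xi> p) (mean_hess p)) (at p)"
    by (rule frechet_derivative_cong_open[OF open_S p mean_curvature_normal_section])
      (use d\<xi> \<xi>(2) p in \<open>auto intro!: differentiable_form differentiable_Cf differentiable_mean_hess\<close>)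
  hence "nabla_mean_curvature C G f X \<xi> p =
      amb p (nab \<xi> p (X p)) (mean_hess p) + amb p (\<xi> p) (nab mean_hess p (X p))
      - 2 * weight p (X p) * amb p (\<xi> p) (mean_hess p)
      - amb p (nab \<xi> p (X p)) (normal_part C f p (mean_hess p))"
    by (simp add: nabla_mean_curvature_def 1 nab_metric[OF p d\<xi>[OF p] differentiable_mean_hess[OF p]])
  also have "\<dots> = amb p (\<xi> p) (nab mean_hess p (X p) - (2 * weight p (X p)) *\<^sub>R mean_hess p
      - hess_form p (X p) (tang p (mean_hess p)))"
    using nab_normal_section[OF p d\<xi>[OF p] \<xi>(2), of "X p" "tang p (mean_hess p)"]
    by (simp add: normal_part_def form_bilinear)
  also have "nab mean_hess p (X p) - (2 * weight p (X p)) *\<^sub>R mean_hess p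
      - hess_form p (X p) (tang p (mean_hess p)) = (\<Sum>c\<in>UNIV. X p $ c *\<^sub>R mean_hess_deriv c p)"
  proof -
    have "weight p (X p) = (\<Sum>c\<in>UNIV. X p $ c * weight p (axis c 1))"
      by (simp add: df_frame[OF p, of "X p"] weight_form_linear frame_def)
    moreover have "hess_form p (X p) w = (\<Sum>c\<in>UNIV. X p $ c *\<^sub>R hess_form p (axis c 1) w)" for w
      by (subst vec_axis_sum[of "X p"]) (simp only: hess_form_bilinear)
    ultimately show ?thesis
      by (simp add: mean_hess_deriv_def nab_linear_direction[OF p differentiable_mean_hess[OF p], of "X p"]
          scaleR_diff_right sum_subtractf scaleR_sum_left sum_distrib_left mult_ac)
  qed
  finally show ?thesis by (simp add: form_bilinear amb_sym[OF p])
qed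

text \<open>The traced Codazzi equation, valid in every codimension; the factor n - 1 clears the
  denominator in front of the divergence.\<close>

lemma mixed_schouten_weyl_curvature:
  assumes p: "p \<in> S" and n: "CARD('n) > 1" and X: "\<And>p. p \<in> S \<Longrightarrow> X differentiable (at p)"
    and \<xi>: "smooth_on S \<xi>" "\<And>p. p \<in> S \<Longrightarrow> is_normal C f p (\<xi> p)"
  shows "(real CARD('n) - 1) * mixed_schouten_weyl C G f X \<xi> p =
    (real CARD('n) - 1) * schouten_weyl C G (f p) (df f p (X p)) (\<xi> p)
    + (\<Sum>a\<in>UNIV. \<Sum>b\<in>UNIV. gram_inv p $ a $ b *
        amb p (curvature G (\<lambda>_. frame a p) (\<lambda>_. df f p (X p)) (\<lambda>_. frame b p) (f p)) (\<xi> p))"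
proof -
  have H: "nabla_mean_curvature C G f X \<xi> p = (\<Sum>c\<in>UNIV. X p $ c * amb p (mean_hess_deriv c p) (\<xi> p))"
    by (rule nabla_mean_curvature_eq) (use assms in auto)
  have \<delta>: "amb p (delta_B0 C G f X p) (\<xi> p) =
    (\<Sum>c\<in>UNIV. X p $ c * ((\<Sum>a\<in>UNIV. \<Sum>b\<in>UNIV. gram_inv p $ a $ b * amb p (hess_deriv a c b p) (\<xi> p))
      - amb p (mean_hess_deriv c p) (\<xi> p)))"
    by (rule amb_delta_B0) (use assms in auto)
  have "(\<Sum>a\<in>UNIV. \<Sum>b\<in>UNIV. gram_inv p $ a $ b * amb p (hess_deriv a c b p) (\<xi> p))
      - real CARD('n) * amb p (mean_hess_deriv c p) (\<xi> p) =
      (\<Sum>a\<in>UNIV. \<Sum>b\<in>UNIV. gram_inv p $ a $ b * amb p (hess_deriv a c b p - hess_deriv c a b p) (\<xi> p))" for c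
    using arg_cong[OF trace_hess_deriv[OF p, of c], of "\<lambda>v. amb p v (\<xi> p)"]
    by (simp add: form_bilinear right_diff_distrib sum_subtractf)
  hence "(\<Sum>c\<in>UNIV. X p $ c * ((\<Sum>a\<in>UNIV. \<Sum>b\<in>UNIV. gram_inv p $ a $ b * amb p (hess_deriv a c b p) (\<xi> p))
      - real CARD('n) * amb p (mean_hess_deriv c p) (\<xi> p))) =
      (\<Sum>c\<in>UNIV. X p $ c * (\<Sum>a\<in>UNIV. \<Sum>b\<in>UNIV. gram_inv p $ a $ b *
        amb p (curvature G (\<lambda>_. frame a p) (\<lambda>_. frame c p) (\<lambda>_. frame b p) (f p)) (\<xi> p)))"
    by (simp only: codazzi[OF p])
  also have "\<dots> = (\<Sum>a\<in>UNIV. \<Sum>b\<in>UNIV. gram_inv p $ a $ b *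
        amb p (curvature G (\<lambda>_. frame a p) (\<lambda>_. df f p (X p)) (\<lambda>_. frame b p) (f p)) (\<xi> p))"
  proof -
    have "curvature G (\<lambda>_. frame a p) (\<lambda>_. df f p (X p)) (\<lambda>_. frame b p) (f p) =
        (\<Sum>c\<in>UNIV. X p $ c *\<^sub>R curvature G (\<lambda>_. frame a p) (\<lambda>_. frame c p) (\<lambda>_. frame b p) (f p))" for a b
      \<comment> \<open>Antisymmetry moves \<open>X\<close> into the first slot, where linearity has
        been established.\<close>
      unfolding curvature_antisym[of "frame a p"] df_frame[OF p, of "X p"]
      by (simp add: linear_sum[OF linear_curvature[OF f_in[OF p]]]
          linear_scale[OF linear_curvature[OF f_in[OF p]]] sum_negf)
    hence "(\<Sum>a\<in>UNIV. \<Sum>b\<in>UNIV. gram_inv p $ a $ b *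
        amb p (curvature G (\<lambda>_. frame a p) (\<lambda>_. df f p (X p)) (\<lambda>_. frame b p) (f p)) (\<xi> p)) =
      (\<Sum>a\<in>UNIV. \<Sum>b\<in>UNIV. \<Sum>c\<in>UNIV. X p $ c * (gram_inv p $ a $ b *
        amb p (curvature G (\<lambda>_. frame a p) (\<lambda>_. frame c p) (\<lambda>_. frame b p) (f p)) (\<xi> p)))"
      by (simp add: form_bilinear sum_distrib_left mult_ac)
    also have "\<dots> = (\<Sum>c\<in>UNIV. \<Sum>a\<in>UNIV. \<Sum>b\<in>UNIV. X p $ c * (gram_inv p $ a $ b *
        amb p (curvature G (\<lambda>_. frame a p) (\<lambda>_. frame c p) (\<lambda>_. frame b p) (f p)) (\<xi> p)))"
      by (subst sum.swap[of _ _ UNIV], subst (2) sum.swap) (rule refl)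
    finally show ?thesis by (simp add: sum_distrib_left)
  qed
  finally have trace: "(\<Sum>a\<in>UNIV. \<Sum>b\<in>UNIV. gram_inv p $ a $ b *
        amb p (curvature G (\<lambda>_. frame a p) (\<lambda>_. df f p (X p)) (\<lambda>_. frame b p) (f p)) (\<xi> p)) =
      amb p (delta_B0 C G f X p) (\<xi> p) - (real CARD('n) - 1) * nabla_mean_curvature C G f X \<xi> p"
    unfolding H \<delta> by (simp add: algebra_simps sum_distrib_left sum_subtractf sum.distrib)
  show ?thesis
    unfolding mixed_schouten_weyl_def trace using n by (simp add: right_diff_distrib distrib_left)
qed

section \<open>Hypersurfaces\<close>

text \<open>Otherwise the tangent space, \<open>\<eta>\<close> and \<open>y\<close> would be
  mutually orthogonal and span n + 2 dimensions in a space of dimension n + 1.\<close>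

lemma normal_line:
  assumes p: "p \<in> S" and dim: "CARD('m) = CARD('n) + 1"
    and \<eta>: "is_normal C f p \<eta>" "\<eta> \<noteq> 0" and y: "is_normal C f p y" "amb p y \<eta> = 0"
  shows "y = 0"
proof (rule ccontr)
  assume "y \<noteq> 0"
  define L :: "(real^'n) \<times> real \<times> real \<Rightarrow> real^'m"
    where "L = (\<lambda>(w, s, t). df f p w + s *\<^sub>R \<eta> + t *\<^sub>R y)"
  have lin: "linear L"
    unfolding L_def using linear_df[OF p]
    by (intro linearI) (auto simp: linear_add linear_scale algebra_simps)
  have "w = 0 \<and> s = 0 \<and> t = 0" if "L (w, s, t) = 0" for w s t
  proof -
    have eq: "df f p w + s *\<^sub>R \<eta> + t *\<^sub>R y = 0" using that by (simp add: L_def)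
    have "amb p (df f p w) \<eta> = 0" "amb p (df f p w) y = 0" "amb p \<eta> y = 0"
      using \<eta>(1) y amb_sym[OF p] by (auto simp: is_normal_def)
    hence "s * amb p \<eta> \<eta> = 0" "t * amb p y y = 0"
      using arg_cong[OF eq, of "\<lambda>v. amb p v \<eta>"] arg_cong[OF eq, of "\<lambda>v. amb p v y"] y(2)
      by (simp_all add: form_bilinear)
    hence st: "s = 0" "t = 0"
      using positive_C[OF f_in[OF p], of \<eta>] positive_C[OF f_in[OF p], of y] \<eta>(2) \<open>y \<noteq> 0\<close> by auto
    with eq have "df f p w = df f p 0" by (simp add: linear_0[OF linear_df[OF p]])
    with st show ?thesis using inj_df[OF p] by (auto dest: injD)
  qed
  hence "inj L" unfolding linear_injective_0[OF lin] by (auto simp: prod_eq_iff)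
  hence "dim (range L) = DIM((real^'n) \<times> real \<times> real)"
    using dim_image_eq[OF lin, of UNIV] by (simp add: inj_on_subset dim_UNIV)
  moreover have "dim (range L) \<le> DIM(real^'m)" by (rule dim_subset_UNIV)
  ultimately show False using dim by simp
qed

lemma hypersurface_decomposition:
  assumes p: "p \<in> S" and dim: "CARD('m) = CARD('n) + 1"
    and \<eta>: "is_normal C f p \<eta>" "\<eta> \<noteq> 0"
  shows "z = df f p (tang p z) + (amb p z \<eta> / amb p \<eta> \<eta>) *\<^sub>R \<eta>"
proof -
  have "amb p \<eta> \<eta> \<noteq> 0" using positive_C[OF f_in[OF p] \<eta>(2)] by simp
  hence "normal_part C f p z - (amb p z \<eta> / amb p \<eta> \<eta>) *\<^sub>R \<eta> = 0"
    using normal_normal_part[OF p, of z] \<eta>(1)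
    by (intro normal_line[OF p dim \<eta>])
      (simp_all add: is_normal_def form_bilinear amb_normal_part[OF p \<eta>(1)])
  thus ?thesis by (simp add: normal_part_def algebra_simps)
qed

text \<open>A trace may be computed in the basis of frame fields and \<open>\<eta>\<close>.
  Decomposing each coordinate vector in it avoids a change-of-basis matrix.\<close>

lemma hypersurface_trace:
  assumes p: "p \<in> S" and dim: "CARD('m) = CARD('n) + 1"
    and \<eta>: "is_normal C f p \<eta>" "\<eta> \<noteq> 0" and \<Phi>: "linear \<Phi>"
  shows "(\<Sum>k\<in>UNIV. \<Phi> (axis k 1) $ k) =
    (\<Sum>a\<in>UNIV. \<Sum>b\<in>UNIV. gram_inv p $ a $ b * amb p (\<Phi> (frame a p)) (frame b p))
    + amb p (\<Phi> \<eta>) \<eta> / amb p \<eta> \<eta>"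
proof -
  \<comment> \<open>This sum over the coordinate basis eliminates the components left by the
    decomposition.\<close>
  have comp: "(\<Sum>k\<in>UNIV. amb p (axis k 1) u * v $ k) = amb p v u" for u v
    by (subst (2) vec_axis_sum[of v]) (simp only: form_bilinear mult.commute)
  have "\<Phi> (axis k 1) = \<Phi> (df f p (tang p (axis k 1)) + (amb p (axis k 1) \<eta> / amb p \<eta> \<eta>) *\<^sub>R \<eta>)" for k
    by (rule arg_cong[OF hypersurface_decomposition[OF p dim \<eta>]])
  hence "\<Phi> (axis k 1) $ k = (\<Sum>a\<in>UNIV. \<Sum>b\<in>UNIV. gram_inv p $ a $ b *
      (amb p (axis k 1) (frame b p) * \<Phi> (frame a p) $ k))
      + amb p (axis k 1) \<eta> * \<Phi> \<eta> $ k / amb p \<eta> \<eta>" for k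
    by (simp add: linear_add[OF \<Phi>] linear_scale[OF \<Phi>] df_frame[OF p] linear_sum[OF \<Phi>]
        tang_component sum_distrib_right mult.assoc)
  hence "(\<Sum>k\<in>UNIV. \<Phi> (axis k 1) $ k) = (\<Sum>k\<in>UNIV. \<Sum>a\<in>UNIV. \<Sum>b\<in>UNIV. gram_inv p $ a $ b *
      (amb p (axis k 1) (frame b p) * \<Phi> (frame a p) $ k))
      + (\<Sum>k\<in>UNIV. amb p (axis k 1) \<eta> * \<Phi> \<eta> $ k) / amb p \<eta> \<eta>"
    by (simp add: sum.distrib sum_divide_distrib)
  also have "(\<Sum>k\<in>UNIV. \<Sum>a\<in>UNIV. \<Sum>b\<in>UNIV. gram_inv p $ a $ b *
      (amb p (axis k 1) (frame b p) * \<Phi> (frame a p) $ k)) =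
    (\<Sum>a\<in>UNIV. \<Sum>b\<in>UNIV. \<Sum>k\<in>UNIV. gram_inv p $ a $ b *
      (amb p (axis k 1) (frame b p) * \<Phi> (frame a p) $ k))"
    by (subst sum.swap, intro sum.cong[OF refl] sum.swap)
  finally show ?thesis by (simp only: comp sum_distrib_left[symmetric])
qed

theorem mixed_schouten_weyl_hypersurface:
  assumes p: "p \<in> S" and dim: "CARD('m) = CARD('n) + 1" and n: "CARD('n) > 1"
    and X: "\<And>p. p \<in> S \<Longrightarrow> X differentiable (at p)"
    and \<xi>: "smooth_on S \<xi>" "\<And>p. p \<in> S \<Longrightarrow> is_normal C f p (\<xi> p)"
  shows "mixed_schouten_weyl C G f X \<xi> p = 0"
proof -
  let ?R = "\<lambda>u v. curvature G (\<lambda>_. u) (\<lambda>_. df f p (X p)) (\<lambda>_. v) (f p)"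
  let ?F = "faraday G (f p) (df f p (X p)) (\<xi> p)" and ?Ric = "ricci G (f p) (df f p (X p)) (\<xi> p)"
  note x = f_in[OF p]
  have orth: "amb p (df f p w) (\<xi> p) = 0" "amb p (\<xi> p) (frame b p) = 0" for w b
    using \<xi>(2)[OF p] amb_sym[OF p] by (auto simp: is_normal_def frame_def)
  have "(real CARD('m) - 2) * schouten_weyl C G (f p) (df f p (X p)) (\<xi> p) = ?Ric + ?F"
    by (rule schouten_weyl_orthogonal[OF x orth(1)]) (use n dim in simp)
  \<comment> \<open>The factors m - 2 and n - 1 coincide here.\<close>
  hence \<mu>: "(real CARD('n) - 1) * mixed_schouten_weyl C G f X \<xi> p = ?Ric + ?F +
      (\<Sum>a\<in>UNIV. \<Sum>b\<in>UNIV. gram_inv p $ a $ b * amb p (?R (frame a p) (frame b p)) (\<xi> p))"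
    by (subst mixed_schouten_weyl_curvature[where \<xi> = \<xi>]) (use assms in auto)
  have "\<dots> = 0"
  \<comment> \<open>The adapted basis needs a nonzero normal vector; where \<open>\<xi>\<close>
    vanishes, every term is zero.\<close>
  proof (cases "\<xi> p = 0")
    case True
    thus ?thesis by (simp add: ricci_zero_right faraday_zero_right[OF x] form_bilinear)
  next
    case False
    have skew: "amb p (?R u (\<xi> p)) w = 2 * faraday G (f p) u (df f p (X p)) * amb p (\<xi> p) w
        - amb p (?R u w) (\<xi> p)" for u w
      using curvature_skew[OF x, of u "df f p (X p)" "\<xi> p" w] amb_sym[OF p, of "\<xi> p" "?R u w"] by simp
    have "?Ric = (\<Sum>a\<in>UNIV. \<Sum>b\<in>UNIV. gram_inv p $ a $ b * amb p (?R (frame a p) (\<xi> p)) (frame b p))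
        + amb p (?R (\<xi> p) (\<xi> p)) (\<xi> p) / amb p (\<xi> p) (\<xi> p)"
      unfolding ricci_def
      by (rule hypersurface_trace[OF p dim \<xi>(2)[OF p] False linear_curvature[OF x]])
    \<comment> \<open>With both arguments equal to \<open>\<xi> p\<close>, the skew identity
      evaluates the normal contribution as F(\<open>\<xi>\<close>, X), and antisymmetry gives the
      sign.\<close>
    also have "amb p (?R (\<xi> p) (\<xi> p)) (\<xi> p) / amb p (\<xi> p) (\<xi> p) = - ?F"
      using skew[of "\<xi> p" "\<xi> p"] positive_C[OF x False] faraday_antisym[OF x, of "\<xi> p" "df f p (X p)"]
      by (simp add: field_simps)
    finally show ?thesis
      by (simp add: skew orth sum_negf)
  qed
  with \<mu> n show ?thesis by simp
qed

end

theorem proposition4p18: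
  fixes T T' :: "'a topology"
    and A :: "('a, 'm::finite) chart set"
    and c :: "('a, 'm) bilinear_components"
    and B :: "('a, 'n::finite) chart set"
    and \<Gamma> :: "('a, 'm) connection_components"
    and \<phi> :: "('a, 'm) chart" and \<psi> :: "('a, 'n) chart"
    and S :: "(real ^ 'n) set"
    and X :: "real ^ 'n \<Rightarrow> real ^ 'n" and \<xi> :: "real ^ 'n \<Rightarrow> real ^ 'm" and q :: "real ^ 'n"
  assumes "conformal_manifold T A c" and "CARD('m) \<ge> 3"
    and "submanifold T A T' B" and "CARD('m) = CARD('n) + 1"
    and "weyl_structure A c \<Gamma>"
    and "\<phi> \<in> A" and "\<psi> \<in> B"
    and "open S" and "S \<subseteq> overlap \<psi> \<phi>"
    and "smooth_on S X" and "smooth_on S \<xi>"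
    and "\<And>q. q \<in> S \<Longrightarrow> is_normal (c \<phi>) (transition \<psi> \<phi>) q (\<xi> q)"
    and "q \<in> S"
  shows "mixed_schouten_weyl (c \<phi>) (\<Gamma> \<phi>) (transition \<psi> \<phi>) X \<xi> q = 0"
proof -
  have \<phi>: "is_chart T \<phi>" and \<psi>: "is_chart T' \<psi>" and c: "conformal_structure A c"
    using assms(1,3,6,7) by (auto simp: conformal_manifold_def submanifold_def smooth_manifold_def)
  have sub: "smooth_on (overlap \<psi> \<phi>) (transition \<psi> \<phi>)"
    "\<And>q. q \<in> overlap \<psi> \<phi> \<Longrightarrow> inj (frechet_derivative (transition \<psi> \<phi>) (at q))"
    using assms(3,6,7) by (auto simp: submanifold_def)
  \<comment> \<open>\<open>transition\<close> inverts the chart by \<open>inv_into\<close>, which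
    returns the original point only by injectivity; hence the inclusion lands in the ambient
    coordinate domain.\<close>
  have inj: "inj_on (snd \<psi>) (fst \<psi>)"
  proof -
    have "openin T' (fst \<psi>)" using \<psi> by (simp add: is_chart_def)
    hence "topspace (subtopology T' (fst \<psi>)) = fst \<psi>"
      by (rule topspace_subtopology_subset[OF openin_subset])
    thus ?thesis
      using \<psi> by (metis homeomorphic_map_def is_chart_def homeomorphic_imp_injective_map)
  qed
  have maps: "transition \<psi> \<phi> p \<in> snd \<phi> ` fst \<phi>" if pS: "p \<in> S" for p
  proof -
    obtain y where y: "y \<in> fst \<psi>" "y \<in> fst \<phi>" "p = snd \<psi> y"
      using subsetD[OF assms(9) pS] by (auto simp: overlap_def)
    thus ?thesis using inj by (simp add: transition_def)
  qed
  interpret immersed_patch "c \<phi>" "\<Gamma> \<phi>" "snd \<phi> ` fst \<phi>" "transition \<psi> \<phi>" S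
  proof unfold_locales
    show "open (snd \<phi> ` fst \<phi>)" using \<phi> by (simp add: is_chart_def)
    show "smooth_on (snd \<phi> ` fst \<phi>) (c \<phi>)" using c assms(6) by (simp add: conformal_structure_def)
    show "smooth_on (snd \<phi> ` fst \<phi>) (\<Gamma> \<phi>)"
      using assms(5,6) by (simp add: weyl_structure_def connection_def)
    show "open S" by fact
    show "smooth_on S (transition \<psi> \<phi>)" by (rule smooth_on_subset[OF sub(1) assms(9)])
  next
    fix x assume "x \<in> snd \<phi> ` fst \<phi>"
    with c assms(6) show "transpose (c \<phi> x) = c \<phi> x" "\<And>u. u \<noteq> 0 \<Longrightarrow> 0 < form (c \<phi> x) u u"
      unfolding conformal_structure_def by blast+
  next
    fix x u v assume "x \<in> snd \<phi> ` fst \<phi>"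
    with assms(5,6) show "christoffel (\<Gamma> \<phi> x) u v = christoffel (\<Gamma> \<phi> x) v u"
      unfolding weyl_structure_def torsion_free_def by blast
  next
    fix x u v w assume "x \<in> snd \<phi> ` fst \<phi>"
    with assms(5,6) show "nabla_L 2 (\<Gamma> \<phi>) (\<lambda>_. w) (\<lambda>y. form (c \<phi> y) u v) x
       - form (c \<phi> x) (nabla_T (\<Gamma> \<phi>) (\<lambda>_. w) (\<lambda>_. u) x) v
       - form (c \<phi> x) u (nabla_T (\<Gamma> \<phi>) (\<lambda>_. w) (\<lambda>_. v) x) = 0"
      unfolding weyl_structure_def by blast
  next
    fix p assume p: "p \<in> S"
    show "transition \<psi> \<phi> p \<in> snd \<phi> ` fst \<phi>" by (rule maps[OF p])
    show "inj (df (transition \<psi> \<phi>) p)"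
      using sub(2)[of p] p assms(9) by (auto simp: df_def[abs_def])
  qed
  \<comment> \<open>The bound m \<ge> 3 enters as n = m - 1 > 1.\<close>
  show ?thesis
    by (rule mixed_schouten_weyl_hypersurface[OF assms(13,4)])
      (use assms smooth_on_differentiable in auto)
qed

end
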